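(* Let $p$ be a prime, and let $f\colon\mathbb F_p^2\to\mathbb C$ be a nonzero function. Write $S:=\operatorname{supp} f\subseteq\mathbb F_p^2$ and $X:=\operatorname{supp}\hat f\subseteq\widehat{\mathbb F_p^2}$. Then for any real $\varepsilon\in(0,1)$ we have either $$\min\{|S|,|X|\}\ge3(1-\varepsilon)p$$ or $$\max\{|S|,|X|\}\ge\frac16\,\varepsilon p^{4/3},$$ except if the smallest of the sets $S$ and $X$ is contained in a coset of a nonzero, proper subgroup (of the corresponding group), or in a union of two such cosets (possibly corresponding to different subgroups).
   Context: $\mathbb F_p^2$ is regarded as an additive group $G$; $\widehat G$ is its group of complex characters. For $f\colon G\to\mathbb C$, the Fourier transform $\hat f\colon\widehat G\to\mathbb C$ is $\hat f(\chi)=\frac1{|G|}\sum_{g\in G}f(g)\overline{\chi(g)}$. The corresponding group is $\mathbb F_p^2$ for $S$ and $\widehat{\mathbb F_p^2}$ for $X$. The support $\operatorname{supp}$ of a function is the set of points where it is nonzero. *)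

theory Defs
  imports
    "HOL-Analysis.Analysis"
    "HOL-Algebra.Coset"
    "Berlekamp_Zassenhaus.Finite_Field"
begin

definition additive_group :: "'a::ab_group_add monoid" where
  "additive_group = \<lparr>carrier = UNIV, mult = (+), one = 0\<rparr>"

definition complex_mult_group :: "complex monoid" where
  "complex_mult_group = \<lparr>carrier = {z. z \<noteq> 0}, mult = (*), one = 1\<rparr>"

text \<open>
  Characters are homomorphisms into the nonzero complex numbers; on a finite group their values
  automatically have modulus one.  They are made extensional outside the carrier so that distinct
  elements of the dual group are distinct characters (no condition if the carrier is everything).
\<close>

definition dual_group :: "('a, 'b) monoid_scheme \<Rightarrow> ('a \<Rightarrow> complex) monoid" where
  "dual_group G =
     \<lparr>carrier = hom G complex_mult_group \<inter> extensional (carrier G),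
      mult = (\<lambda>\<phi> \<psi>. \<lambda>g\<in>carrier G. \<phi> g * \<psi> g),
      one = (\<lambda>g\<in>carrier G. 1)\<rparr>"

definition fourier :: "('a, 'b) monoid_scheme \<Rightarrow> ('a \<Rightarrow> complex) \<Rightarrow> ('a \<Rightarrow> complex) \<Rightarrow> complex" where
  "fourier G f \<phi> = 1 / of_nat (order G) * (\<Sum>g\<in>carrier G. f g * cnj (\<phi> g))"

text \<open>
  The groups considered are abelian, so the right cosets below are all the cosets.
\<close>

definition proper_cosets :: "('a, 'b) monoid_scheme \<Rightarrow> 'a set set" where
  "proper_cosets G =
     {C. \<exists>H. subgroup H G \<and> H \<noteq> {\<one>\<^bsub>G\<^esub>} \<and> H \<noteq> carrier G \<and> C \<in> rcosets\<^bsub>G\<^esub> H}"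

definition in_one_or_two_proper_cosets :: "('a, 'b) monoid_scheme \<Rightarrow> 'a set \<Rightarrow> bool" where
  "in_one_or_two_proper_cosets G A \<longleftrightarrow>
     (\<exists>C\<in>proper_cosets G. A \<subseteq> C) \<or>
     (\<exists>C\<in>proper_cosets G. \<exists>D\<in>proper_cosets G. A \<subseteq> C \<union> D)"

lemma comm_group_additive_group: "comm_group (additive_group :: 'a::ab_group_add monoid)"
proof (rule comm_groupI)
  fix x :: 'a
  assume "x \<in> carrier additive_group"
  show "\<exists>y\<in>carrier additive_group. y \<otimes>\<^bsub>additive_group\<^esub> x = \<one>\<^bsub>additive_group\<^esub>"
    by (rule bexI[of _ "- x"]) (simp_all add: additive_group_def)
qed (simp_all add: additive_group_def add_ac)

lemma comm_group_dual_group: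
  assumes "group G"
  shows "comm_group (dual_group G)"
proof (rule comm_groupI)
  interpret group G by fact
  fix \<phi>
  assume \<phi>: "\<phi> \<in> carrier (dual_group G)"
  show "\<exists>\<psi>\<in>carrier (dual_group G). \<psi> \<otimes>\<^bsub>dual_group G\<^esub> \<phi> = \<one>\<^bsub>dual_group G\<^esub>"
    using \<phi> by (intro bexI[of _ "\<lambda>g\<in>carrier G. inverse (\<phi> g)"])
      (auto simp: dual_group_def complex_mult_group_def hom_def Pi_iff intro!: restrict_ext)
next
  interpret group G by fact
  show "\<one>\<^bsub>dual_group G\<^esub> \<in> carrier (dual_group G)"
    by (auto simp: dual_group_def complex_mult_group_def hom_def)
qed (use assms in \<open>auto simp: dual_group_def complex_mult_group_def hom_def Pi_iff mult_ac
       group.is_monoid monoid.m_closed extensional_def intro!: restrict_ext ext\<close>)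

end

theory Submission
  imports Defs
begin

text \<open>
  Identify the dual of \<open>\<F>\<^sub>p\<^sup>2\<close> with \<open>\<F>\<^sub>p\<^sup>2\<close> and say that \<open>|S| \<le> |X|\<close>; the other case follows
  by exchanging \<open>f\<close> and its Fourier transform. Assume \<open>|S| < 3(1 - \<epsilon>)p\<close> and \<open>|X| < \<epsilon>p\<^bsup>4/3\<^esup>/6\<close>.
  It has to be shown that two lines cover \<open>S\<close>.

  The one-dimensional input is the uncertainty principle of Biro, Meshulam and Tao in the form
  \<open>exponential_sum_zeros\<close>: a nonzero exponential sum over \<open>\<F>\<^sub>p\<close> with \<open>m\<close> frequencies has fewer
  than \<open>m\<close> zeros. Applied twice, along and across a direction, it gives
  \<open>directional_uncertainty\<close>: if \<open>S\<close> meets exactly \<open>N\<close> lines of some direction, one of them in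
  exactly \<open>m\<close> points, then \<open>|X| \<ge> (p + 1 - m)(p + 1 - N)\<close>.

  The key step is \<open>line_bound\<close>, a gap in the possible sizes of the intersections of \<open>S\<close> with
  lines. In coordinates \<open>(c, y)\<close> whose first component labels the lines of a direction, let
  \<open>g\<^sub>t(c)\<close> be the sum of \<open>f(c, y) e(ty)\<close> over \<open>y\<close>, where \<open>e\<close> is a nontrivial additive character.
  As a function of \<open>c\<close>, \<open>g\<^sub>t\<close> has Fourier support of size \<open>|X\<^sub>t|\<close>, the size of the \<open>t\<close>-th slice of
  \<open>X\<close>. As a function of \<open>t\<close>, it is an exponential sum with \<open>|S \<inter> c|\<close> frequencies. Consider the
  three by three determinant with rows \<open>(g\<^sub>r, g\<^sub>r\<^sub>+\<^sub>1, g\<^sub>r\<^sub>+\<^sub>2)\<close> and similarly for \<open>s\<close> and \<open>t\<close>. It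
  vanishes at every line \<open>c\<close> with at most two points of \<open>S\<close>, and by the bound on \<open>|S|\<close> there are
  more than \<open>\<epsilon>p\<close> of these. The size of its Fourier support is at most a sum of six products of
  three slice sizes, and over all \<open>(r, s, t)\<close> this adds up to \<open>6|X|\<^sup>3\<close>. So the determinant vanishes
  identically in \<open>c\<close> for all but \<open>6|X|\<^sup>3/(\<epsilon>p) < p\<^sup>3/27\<close> of the triples. On the other hand, at a line
  with \<open>m \<ge> 3\<close> points of \<open>S\<close> the determinant is nonzero for at least \<open>(p + 1 - m)\<^sup>3\<close> triples.
  Hence a line with at least three points of \<open>S\<close> has more than \<open>2p/3\<close> of them; call it rich.

  There are at most four rich lines. Multiplying \<open>f\<close> by \<open>1 - e(a\<cdot>x - c)\<close> deletes a line from \<open>S\<close> and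
  at most doubles \<open>|X|\<close>. If deleting all rich lines leaves a nonempty set, this set has at most two
  points on every line; counting its pairs of points by direction produces a direction in which it
  meets little more than \<open>p/2\<close> lines, and \<open>directional_uncertainty\<close> makes \<open>|X|\<close> of order \<open>p\<^sup>2\<close>, a
  contradiction. So the rich lines cover \<open>S\<close>. If there are three or more, some rich line has fewer
  than \<open>(1 - \<epsilon>)p\<close> points of \<open>S\<close> on no other rich line, but at least one. Deleting the other
  rich lines leaves a set inside one line, and \<open>directional_uncertainty\<close> gives \<open>8|X| \<ge> \<epsilon>p\<^sup>2\<close>, again
  a contradiction.
\<close>

section \<open>Sparse polynomials at roots of unity\<close>

text \<open>
  \<open>diff_vanishes n q\<close> says that the \<open>n\<close>-th forward difference of the integer sequence \<open>q\<close> is zero,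
  that is, that \<open>q\<close> is given by a polynomial of degree less than \<open>n\<close>.
\<close>

fun diff_vanishes :: "nat \<Rightarrow> (nat \<Rightarrow> int) \<Rightarrow> bool" where
  "diff_vanishes 0 q \<longleftrightarrow> (\<forall>j. q j = 0)"
| "diff_vanishes (Suc n) q \<longleftrightarrow> diff_vanishes n (\<lambda>j. q (Suc j) - q j)"

lemma diff_vanishes_add:
  "diff_vanishes n q \<Longrightarrow> diff_vanishes n r \<Longrightarrow> diff_vanishes n (\<lambda>j. q j + r j)"
proof (induction n arbitrary: q r)
  case (Suc n)
  have "diff_vanishes n (\<lambda>j. (q (Suc j) - q j) + (r (Suc j) - r j))"
    using Suc by simp
  thus ?case by (simp add: algebra_simps)
qed auto

lemma diff_vanishes_shift: "diff_vanishes n q \<Longrightarrow> diff_vanishes n (\<lambda>j. q (Suc j))"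
proof (induction n arbitrary: q)
  case (Suc n)
  from Suc.IH[of "\<lambda>j. q (Suc j) - q j"] Suc.prems show ?case by simp
qed auto

lemma diff_vanishes_mult_linear:
  "diff_vanishes n q \<Longrightarrow> diff_vanishes (Suc n) (\<lambda>j. (int j - c) * q j)"
proof (induction n arbitrary: q)
  case (Suc n)
  have "diff_vanishes (Suc n) (\<lambda>j. (int j - c) * (q (Suc j) - q j))"
    using Suc.prems by (intro Suc.IH) simp
  moreover have "diff_vanishes (Suc n) (\<lambda>j. q (Suc j))"
    by (rule diff_vanishes_shift[OF Suc.prems])
  ultimately have "diff_vanishes (Suc n) (\<lambda>j. (int j - c) * (q (Suc j) - q j) + q (Suc j))"
    by (rule diff_vanishes_add)
  moreover have "(\<lambda>j. (int j - c) * (q (Suc j) - q j) + q (Suc j)) =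
    (\<lambda>j. (int (Suc j) - c) * q (Suc j) - (int j - c) * q j)"
    by (auto simp: algebra_simps)
  ultimately show ?case by simp
qed auto

lemma diff_vanishes_prod:
  "finite B \<Longrightarrow> diff_vanishes (Suc (card B)) (\<lambda>j. \<Prod>b\<in>B. int j - b)"
proof (induction B rule: finite_induct)
  case (insert b B)
  from diff_vanishes_mult_linear[OF insert.IH, of b] insert.hyps
  show ?case by simp
qed auto

text \<open>
  Think of \<open>N\<close> as \<open>\<pi>M\<close>, where \<open>1 - z\<close> maps \<open>M\<close> into \<open>N\<close> for all \<open>z \<in> Z\<close>: modulo \<open>N\<close>, a
  polynomial over \<open>M\<close> with \<open>n\<close> roots in \<open>Z\<close> is divisible by the \<open>n\<close>-th power of \<open>x - 1\<close>, so all
  moments of its coefficients of order less than \<open>n\<close> lie in \<open>N\<close>. The induction divides by one linear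
  factor at a time, which turns the weight \<open>q\<close> into its forward difference.
\<close>

lemma moment_mem:
  fixes M N Z :: "complex set"
  assumes M0: "0 \<in> M" and Madd: "\<And>x y. x \<in> M \<Longrightarrow> y \<in> M \<Longrightarrow> x + y \<in> M"
    and Mint: "\<And>k x. x \<in> M \<Longrightarrow> of_int k * x \<in> M"
    and N0: "0 \<in> N" and Nadd: "\<And>x y. x \<in> N \<Longrightarrow> y \<in> N \<Longrightarrow> x + y \<in> N"
    and MZ: "\<And>z x. z \<in> Z \<Longrightarrow> x \<in> M \<Longrightarrow> z * x \<in> M"
    and NZ: "\<And>z x. z \<in> Z \<Longrightarrow> x \<in> M \<Longrightarrow> (1 - z) * x \<in> N"
  shows "finite W \<Longrightarrow> W \<subseteq> Z \<Longrightarrow> (\<And>j. Polynomial.coeff P j \<in> M) \<Longrightarrow> (\<And>j. j \<ge> d \<Longrightarrow> Polynomial.coeff P j = 0) \<Longrightarrow>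
    (\<And>z. z \<in> W \<Longrightarrow> poly P z = 0) \<Longrightarrow> diff_vanishes (card W) q \<Longrightarrow>
    (\<Sum>j<d. Polynomial.coeff P j * of_int (q j)) \<in> N"
proof (induction W arbitrary: P q d rule: finite_induct)
  case empty
  thus ?case using N0 by simp
next
  case (insert z W)
  define R where "R = synthetic_div P z"
  have P: "P = [:- z, 1:] * R"
    using synthetic_div_correct'[of z P] insert.prems(4)[of z] by (simp add: R_def)
  have cP0: "Polynomial.coeff P 0 = - z * Polynomial.coeff R 0"
    unfolding P by simp
  have cPS: "Polynomial.coeff P (Suc j) = Polynomial.coeff R j - z * Polynomial.coeff R (Suc j)" for j
    unfolding P by simp
  have zZ: "z \<in> Z" using insert.prems by auto
  \<comment> \<open>synthetic division computes the coefficients of \<open>R\<close> from the top down\<close>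
  have RM: "Polynomial.coeff R j \<in> M" for j
  proof (induction "Suc (Polynomial.degree R) - j" arbitrary: j)
    case 0
    hence "Polynomial.coeff R j = 0" by (intro coeff_eq_0) auto
    thus ?case using M0 by simp
  next
    case (Suc x)
    hence "Polynomial.coeff R (Suc j) \<in> M" by auto
    hence "Polynomial.coeff P (Suc j) + z * Polynomial.coeff R (Suc j) \<in> M"
      using Madd MZ zZ insert.prems(2) by blast
    thus ?case using cPS[of j] by simp
  qed
  have Rroot: "poly R w = 0" if "w \<in> W" for w
  proof -
    have "w \<noteq> z" using that insert.hyps by auto
    moreover have "poly P w = 0" using insert.prems(4) that by auto
    ultimately show ?thesis unfolding P by (auto simp: algebra_simps)
  qed
  show ?case
  proof (cases d)
    case 0
    thus ?thesis using N0 by simp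
  next
    case (Suc d')
    have Rdeg: "Polynomial.coeff R j = 0" if "j \<ge> d'" for j
      using that
    proof (induction "Suc (Polynomial.degree R) - j" arbitrary: j)
      case 0
      thus ?case by (intro coeff_eq_0) auto
    next
      case (Suc x)
      have "Polynomial.coeff R (Suc j) = 0" using Suc by auto
      moreover have "Polynomial.coeff P (Suc j) = 0" using insert.prems(3) \<open>d = Suc d'\<close> Suc.prems by auto
      ultimately show ?case using cPS[of j] by simp
    qed
    have "(\<Sum>j<d. Polynomial.coeff P j * of_int (q j)) = - z * Polynomial.coeff R 0 * of_int (q 0)
       + (\<Sum>j<d'. Polynomial.coeff R j * of_int (q (Suc j))) - (\<Sum>j<d'. z * Polynomial.coeff R (Suc j) * of_int (q (Suc j)))"
      unfolding Suc by (subst sum.lessThan_Suc_shift)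
        (simp add: cP0 cPS algebra_simps sum_subtractf)
    also have "\<dots> = (\<Sum>j<d'. Polynomial.coeff R j * of_int (q (Suc j))) - (\<Sum>j<Suc d'. z * Polynomial.coeff R j * of_int (q j))"
      by (subst sum.lessThan_Suc_shift) simp
    also have "\<dots> = (\<Sum>j<d'. Polynomial.coeff R j * of_int (q (Suc j) - q j))
       + (\<Sum>j<d'. (1 - z) * (of_int (q j) * Polynomial.coeff R j))"
      using Rdeg[of d'] by (simp add: algebra_simps sum_subtractf)
    also have "\<dots> \<in> N"
    proof (rule Nadd)
      show "(\<Sum>j<d'. Polynomial.coeff R j * of_int (q (Suc j) - q j)) \<in> N"
        by (rule insert.IH) (use insert RM Rroot Rdeg in auto)
      show "(\<Sum>j<d'. (1 - z) * (of_int (q j) * Polynomial.coeff R j)) \<in> N"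
        by (induction d') (auto intro!: N0 Nadd NZ Mint RM zZ)
    qed
    finally show ?thesis .
  qed
qed

text \<open>
  A linear functional on \<open>\<complex>\<close> over the rationals turns divisibility questions in a finitely generated
  subgroup of \<open>\<complex>\<close> into questions about rational numbers with bounded denominator.
\<close>

lemma rational_functional:
  assumes "(a::complex) \<noteq> 0"
  obtains L :: "complex \<Rightarrow> rat" where "\<And>x y. L (x + y) = L x + L y"
    and "\<And>r x. L (of_rat r * x) = r * L x" and "L a = 1"
proof -
  interpret vector_space_pair "\<lambda>(r::rat) (z::complex). of_rat r * z" "(*) :: rat \<Rightarrow> rat \<Rightarrow> rat"
    by unfold_locales (auto simp: algebra_simps of_rat_add of_rat_mult)
  have "vs1.independent {a}"
    using assms by (simp add: vs1.independent_insert)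
  from linear_independent_extend[OF this, of "\<lambda>_. 1"]
  obtain g where g: "Vector_Spaces.linear (\<lambda>(r::rat) (z::complex). of_rat r * z) (*) g" "g a = 1"
    by auto
  interpret g: Vector_Spaces.linear "\<lambda>(r::rat) (z::complex). of_rat r * z" "(*)" g by fact
  show ?thesis by (rule that[of g]) (use g in \<open>simp_all add: g.add g.scale\<close>)
qed

text \<open>
  The ring \<open>\<int>[z]\<close>, as a subring of the complex numbers.
\<close>

definition int_adjoin :: "complex \<Rightarrow> complex set" where
  "int_adjoin z = range (\<lambda>q. poly (map_poly of_int q) z)"

lemma int_adjoin_add: "x \<in> int_adjoin z \<Longrightarrow> y \<in> int_adjoin z \<Longrightarrow> x + y \<in> int_adjoin z"
proof (clarsimp simp: int_adjoin_def)
  fix q r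
  have "poly (map_poly of_int q) z + poly (map_poly of_int r) z = poly (map_poly of_int (q + r)) z"
    by (simp add: of_int_poly_hom.hom_add)
  thus "poly (map_poly of_int q) z + poly (map_poly of_int r) z \<in> range (\<lambda>q. poly (map_poly of_int q) z)"
    by blast
qed

lemma int_adjoin_mult: "x \<in> int_adjoin z \<Longrightarrow> y \<in> int_adjoin z \<Longrightarrow> x * y \<in> int_adjoin z"
proof (clarsimp simp: int_adjoin_def)
  fix q r
  have "poly (map_poly of_int q) z * poly (map_poly of_int r) z = poly (map_poly of_int (q * r)) z"
    by (simp add: of_int_poly_hom.hom_mult)
  thus "poly (map_poly of_int q) z * poly (map_poly of_int r) z \<in> range (\<lambda>q. poly (map_poly of_int q) z)"
    by blast
qed

lemma int_adjoin_int: "of_int k \<in> int_adjoin z"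
  unfolding int_adjoin_def by (rule range_eqI[of _ _ "[:k:]"]) (simp add: of_int_hom.map_poly_pCons_hom)

lemma int_adjoin_gen: "z \<in> int_adjoin z"
  unfolding int_adjoin_def by (rule range_eqI[of _ _ "[:0, 1:]"]) (simp add: of_int_hom.map_poly_pCons_hom)

lemma int_adjoin_0: "0 \<in> int_adjoin z" and int_adjoin_1: "1 \<in> int_adjoin z"
  and int_adjoin_nat: "of_nat n \<in> int_adjoin z"
  using int_adjoin_int[of 0 z] int_adjoin_int[of 1 z] int_adjoin_int[of "int n" z] by simp_all

lemma int_adjoin_uminus: "x \<in> int_adjoin z \<Longrightarrow> - x \<in> int_adjoin z"
  using int_adjoin_mult[OF int_adjoin_int[of "-1"]] by fastforce

lemma int_adjoin_power: "x \<in> int_adjoin z \<Longrightarrow> x ^ n \<in> int_adjoin z"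
  by (induction n) (auto intro: int_adjoin_1 int_adjoin_mult)

lemma int_adjoin_sum: "(\<And>i. i \<in> A \<Longrightarrow> g i \<in> int_adjoin z) \<Longrightarrow> sum g A \<in> int_adjoin z"
  by (induction A rule: infinite_finite_induct) (auto intro: int_adjoin_0 int_adjoin_add)

lemma one_minus_power_dvd: "\<exists>u\<in>int_adjoin z. 1 - z ^ k = (1 - z) * u"
  by (rule bexI[of _ "\<Sum>i<k. z ^ i"])
    (auto simp: one_diff_power_eq intro!: int_adjoin_sum int_adjoin_power int_adjoin_gen)

text \<open>
  For a \<open>p\<close>-th root of unity \<open>z\<close>, the \<open>p\<close>-th power of \<open>1 - z\<close> is divisible by \<open>p\<close> in \<open>\<int>[z]\<close>: expand
  it and use that \<open>p\<close> divides the inner binomial coefficients. The two outer terms add up to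
  \<open>0\<close> for odd \<open>p\<close> and to \<open>2\<close> for \<open>p = 2\<close>.
\<close>

lemma prime_dvd_uniformizer_power:
  fixes z :: complex
  assumes "prime p" "z ^ p = 1"
  shows "\<exists>u\<in>int_adjoin z. (1 - z) ^ p = of_nat p * u"
proof -
  define c where "c k = (if k = 0 \<or> k = p then 0 else (p choose k) div p)" for k
  have p0: "p > 0" using assms(1) prime_gt_0_nat by auto
  have c: "(p choose k) = p * c k" if "k \<in> {0<..<p}" for k
    using that assms(1) dvd_choose_prime[of k p] by (auto simp: c_def)
  have "(1 - z) ^ p = (\<Sum>k\<le>p. of_nat (p choose k) * (- z) ^ k)"
    using binomial_ring[of "- z" 1 p] by (simp add: algebra_simps)
  also have "{..p} = insert 0 (insert p {0<..<p})" using p0 by auto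
  also have "(\<Sum>k\<in>insert 0 (insert p {0<..<p}). of_nat (p choose k) * (- z) ^ k)
     = 1 + (- z) ^ p + (\<Sum>k\<in>{0<..<p}. of_nat (p choose k) * (- z) ^ k)"
    using p0 by simp
  also have "(\<Sum>k\<in>{0<..<p}. of_nat (p choose k) * (- z) ^ k) = of_nat p * (\<Sum>k\<in>{0<..<p}. of_nat (c k) * (- z) ^ k)"
    by (simp add: c sum_distrib_left mult.assoc)
  also have "1 + (- z) ^ p = of_nat p * of_nat (if p = 2 then 1 else 0)"
  proof (cases "p = 2")
    case False
    hence "odd p" using assms(1) prime_odd_nat[of p] prime_ge_2_nat[of p] by force
    thus ?thesis using False assms(2) by (simp add: power_minus_odd)
  qed (use assms in \<open>simp add: power2_eq_square\<close>)
  finally have "(1 - z) ^ p = of_nat p *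
    (of_nat (if p = 2 then 1 else 0) + (\<Sum>k\<in>{0<..<p}. of_nat (c k) * (- z) ^ k))"
    by (simp add: algebra_simps)
  moreover have "of_nat (if p = 2 then 1 else 0) + (\<Sum>k\<in>{0<..<p}. of_nat (c k) * (- z) ^ k) \<in> int_adjoin z"
    by (intro int_adjoin_add int_adjoin_sum int_adjoin_mult int_adjoin_nat int_adjoin_power
         int_adjoin_uminus int_adjoin_gen)
  ultimately show ?thesis by blast
qed

text \<open>
  The \<open>\<int>[z]\<close>-submodule of \<open>\<complex>\<close> generated by the numbers \<open>a j\<close> with \<open>j \<in> A\<close>.
\<close>

definition adjoin_span :: "complex \<Rightarrow> 'j set \<Rightarrow> ('j \<Rightarrow> complex) \<Rightarrow> complex set" where
  "adjoin_span z A a = {\<Sum>j\<in>A. r j * a j | r. \<forall>j. r j \<in> int_adjoin z}"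

lemma adjoin_span_add:
  assumes "x \<in> adjoin_span z A a" "y \<in> adjoin_span z A a"
  shows "x + y \<in> adjoin_span z A a"
proof -
  obtain r s where r: "x = (\<Sum>j\<in>A. r j * a j)" "\<forall>j. r j \<in> int_adjoin z"
    and s: "y = (\<Sum>j\<in>A. s j * a j)" "\<forall>j. s j \<in> int_adjoin z"
    using assms unfolding adjoin_span_def by auto
  have "x + y = (\<Sum>j\<in>A. (r j + s j) * a j)"
    using r s by (simp add: algebra_simps sum.distrib)
  moreover have "\<forall>j. r j + s j \<in> int_adjoin z" using r s int_adjoin_add by auto
  ultimately show ?thesis unfolding adjoin_span_def by (intro CollectI exI[of _ "\<lambda>j. r j + s j"]) auto
qed

lemma adjoin_span_mult:
  assumes "x \<in> adjoin_span z A a" "w \<in> int_adjoin z"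
  shows "w * x \<in> adjoin_span z A a"
proof -
  obtain r where r: "x = (\<Sum>j\<in>A. r j * a j)" "\<forall>j. r j \<in> int_adjoin z"
    using assms unfolding adjoin_span_def by auto
  have "w * x = (\<Sum>j\<in>A. (w * r j) * a j)"
    using r by (simp add: algebra_simps sum_distrib_left)
  moreover have "\<forall>j. w * r j \<in> int_adjoin z" using r assms(2) int_adjoin_mult by auto
  ultimately show ?thesis unfolding adjoin_span_def by (intro CollectI exI[of _ "\<lambda>j. w * r j"]) auto
qed

lemma adjoin_span_0: "0 \<in> adjoin_span z A a"
  unfolding adjoin_span_def by (intro CollectI exI[of _ "\<lambda>j. 0"]) (auto intro: int_adjoin_0)

lemma adjoin_span_gen:
  assumes "finite A" "i \<in> A" shows "a i \<in> adjoin_span z A a"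
proof -
  have "a i = (\<Sum>j\<in>A. (if j = i then 1 else 0) * a j)" using assms
    by (simp add: if_distrib[of "\<lambda>x. x * _"] cong: if_cong)
  thus ?thesis unfolding adjoin_span_def
    by (intro CollectI exI[of _ "\<lambda>j. if j = i then 1 else 0"]) (auto intro: int_adjoin_0 int_adjoin_1)
qed

lemma rat_common_denominator:
  fixes g :: "'i \<Rightarrow> rat"
  assumes "finite I"
  shows "\<exists>D::int. D \<noteq> 0 \<and> (\<forall>i\<in>I. of_int D * g i \<in> \<int>)"
  using assms
proof (induction I rule: finite_induct)
  case (insert i I)
  then obtain D where D: "D \<noteq> 0" "\<forall>i\<in>I. of_int D * g i \<in> \<int>" by auto
  obtain a b where ab: "quotient_of (g i) = (a, b)" by force
  have b: "b > 0" "g i = of_int a / of_int b"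
    using quotient_of_denom_pos[OF ab] quotient_of_div[OF ab] by auto
  have "of_int (b * D) * g j \<in> \<int>" if "j \<in> insert i I" for j
  proof (cases "j = i")
    case True
    have "of_int (b * D) * g j = of_int (D * a)" using b True by simp
    thus ?thesis by (metis Ints_of_int)
  next
    case False
    hence "of_int b * (of_int D * g j) \<in> \<int>" using D that by (intro Ints_mult[OF Ints_of_int, of "of_int D * g j"]) auto
    thus ?thesis by (simp add: mult.assoc)
  qed
  thus ?case using D b by (intro exI[of _ "b * D"]) auto
qed (auto intro: exI[of _ 1])

text \<open>
  The module generated by the \<open>a j\<close> is a finitely generated subgroup of \<open>\<complex>\<close>, so it can only be
  divisible by \<open>p\<close> if it is zero.
\<close>

lemma adjoin_span_not_divisible:
  fixes z :: complex
  assumes "p > 1" "z ^ p = 1" "finite A"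
    and div: "\<And>x. x \<in> adjoin_span z A a \<Longrightarrow> \<exists>y\<in>adjoin_span z A a. x = of_nat p * y"
    and "i \<in> A"
  shows "a i = 0"
proof (rule ccontr)
  assume "a i \<noteq> 0"
  then obtain L :: "complex \<Rightarrow> rat" where L: "\<And>x y. L (x + y) = L x + L y"
     "\<And>r x. L (of_rat r * x) = r * L x" "L (a i) = 1"
    using rational_functional by blast
  have L0: "L 0 = 0" using L(2)[of 0 0] by simp
  have Lint: "L (of_int k * x) = of_int k * L x" for k x using L(2)[of "of_int k" x] by simp
  have Lsum: "L (sum g B) = (\<Sum>b\<in>B. L (g b))" for g :: "'b \<Rightarrow> complex" and B
    by (induction B rule: infinite_finite_induct) (auto simp: L L0)
  obtain D :: int where D: "D \<noteq> 0" "\<forall>(k, j)\<in>{..<p} \<times> A. of_int D * L (z ^ k * a j) \<in> \<int>"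
    using rat_common_denominator[of "{..<p} \<times> A" "\<lambda>(k, j). L (z ^ k * a j)"] assms(3) by auto
  have D': "of_int D * L (z ^ k * a j) \<in> \<int>" if "j \<in> A" for k j
  proof -
    have "z ^ k = z ^ (k mod p)"
      using assms(2) by (metis mod_mult_div_eq mult.right_neutral power_add power_mult power_one)
    thus ?thesis using D that assms(1) by auto
  qed
  have DL: "of_int D * L x \<in> \<int>" if x: "x \<in> adjoin_span z A a" for x
  proof -
    obtain r where r: "x = (\<Sum>j\<in>A. r j * a j)" "\<forall>j. r j \<in> int_adjoin z"
      using x unfolding adjoin_span_def by auto
    have "of_int D * L (r j * a j) \<in> \<int>" if "j \<in> A" for j
    proof -
      obtain q where q: "r j = poly (map_poly of_int q) z"
        using r(2) by (force simp: int_adjoin_def)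
      have "r j * a j = (\<Sum>k\<le>Polynomial.degree q. of_int (Polynomial.coeff q k) * (z ^ k * a j))"
        unfolding q by (simp add: poly_altdef coeff_map_poly sum_distrib_right mult.assoc)
      hence "of_int D * L (r j * a j) = (\<Sum>k\<le>Polynomial.degree q. of_int (Polynomial.coeff q k) * (of_int D * L (z ^ k * a j)))"
        by (simp add: Lsum Lint sum_distrib_left mult.left_commute[of "of_int D"])
      also have "\<dots> \<in> \<int>" using that by (intro Ints_sum Ints_mult D') auto
      finally show ?thesis .
    qed
    hence "(\<Sum>j\<in>A. of_int D * L (r j * a j)) \<in> \<int>" by (intro Ints_sum)
    thus ?thesis by (simp add: r Lsum sum_distrib_left)
  qed
  have iter: "\<exists>y\<in>adjoin_span z A a. a i = of_nat p ^ k * y" for k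
  proof (induction k)
    case 0
    thus ?case using adjoin_span_gen[OF assms(3,5)] by auto
  next
    case (Suc k)
    then obtain y where y: "y \<in> adjoin_span z A a" "a i = of_nat p ^ k * y" by auto
    with div[of y] show ?case by auto
  qed
  have "int p ^ k dvd D" for k
  proof -
    obtain y where y: "y \<in> adjoin_span z A a" "a i = of_nat p ^ k * y" using iter by auto
    obtain n where n: "of_int D * L y = of_int n" using DL[OF y(1)] by (auto elim: Ints_cases)
    have "1 = of_int (int p ^ k) * L y"
      using L(3) y(2) Lint[of "int p ^ k" y] by simp
    hence "(of_int D::rat) = of_int (int p ^ k) * (of_int D * L y)" by (simp add: algebra_simps)
    also have "\<dots> = of_int (int p ^ k * n)" by (simp add: n)
    finally show ?thesis by (metis dvd_triv_left of_int_eq_iff)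
  qed
  moreover obtain k where "int p ^ k > \<bar>D\<bar>"
    using real_arch_pow[of "real p" "\<bar>real_of_int D\<bar>"] assms(1)
    by (metis of_int_abs of_int_less_iff of_int_of_nat_eq of_int_power of_nat_1 of_nat_less_iff)
  ultimately show False using D(1) by (metis abs_of_nat dvd_imp_le_int linorder_not_le of_nat_power)
qed

text \<open>
  A nonzero polynomial of degree less than \<open>p\<close> with \<open>n\<close> terms has fewer than \<open>n\<close> roots among the
  \<open>p\<close>-th roots of unity; this is equivalent to Chebotarev's theorem on the minors of the Fourier
  matrix. Let \<open>M\<close> be the \<open>\<int>[z]\<close>-module generated by the coefficients and \<open>N = (1 - z)M\<close>.
  If there were \<open>n\<close> roots, then all moments of order less than \<open>n\<close> of the coefficients would lie in
  \<open>N\<close>; choosing the weight that vanishes at all exponents but one, every coefficient lies in \<open>N\<close>.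
  Thus \<open>M = (1 - z)M\<close>, hence \<open>M = pM\<close>, which forces \<open>M = 0\<close>.
\<close>

lemma sparse_polynomial_roots_of_unity:
  fixes z :: complex and a :: "nat \<Rightarrow> complex"
  assumes p: "prime p" and z: "z ^ p = 1" "z \<noteq> 1"
    and A: "A \<subseteq> {..<p}" and W: "finite W" "W \<subseteq> range (\<lambda>k. z ^ k)" "card A \<le> card W"
    and zero: "\<And>w. w \<in> W \<Longrightarrow> (\<Sum>j\<in>A. a j * w ^ j) = 0"
    and i: "i \<in> A"
  shows "a i = 0"
proof -
  have finA: "finite A" using A finite_subset by blast
  define M where "M = adjoin_span z A a"
  define N where "N = (*) (1 - z) ` M"
  have Nadd: "x + y \<in> N" if xy: "x \<in> N" "y \<in> N" for x y
  proof -
    obtain u v where "u \<in> M" "v \<in> M" "x = (1 - z) * u" "y = (1 - z) * v"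
      using xy by (auto simp: N_def)
    thus ?thesis unfolding N_def M_def
      by (intro image_eqI[of _ _ "u + v"]) (auto simp: distrib_left adjoin_span_add)
  qed
  have Nmult: "w * x \<in> N" if "x \<in> N" "w \<in> int_adjoin z" for x w
    using that adjoin_span_mult unfolding N_def M_def by (fastforce simp: mult.left_commute)
  have Mint: "of_int k * x \<in> M" if "x \<in> M" for k x
    using that unfolding M_def by (intro adjoin_span_mult int_adjoin_int)
  have N0: "0 \<in> N" unfolding N_def M_def using adjoin_span_0 by force
  have NZ: "(1 - z ^ k) * x \<in> N" if "x \<in> M" for k x
  proof -
    obtain u where "u \<in> int_adjoin z" "1 - z ^ k = (1 - z) * u" using one_minus_power_dvd by blast
    thus ?thesis using that unfolding N_def M_def
      by (intro image_eqI[of _ _ "u * x"]) (auto simp: mult.assoc adjoin_span_mult)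
  qed
  have pN: "of_nat p * x \<in> N" if "x \<in> M" for x
  proof -
    have "(\<Sum>k<p. z ^ k) = 0"
      using z geometric_sum[of z p] by simp
    hence "of_nat p = (\<Sum>k<p. 1 - z ^ k)" by (simp add: sum_subtractf)
    hence "of_nat p * x = (\<Sum>k<p. (1 - z ^ k) * x)" by (simp add: sum_distrib_right)
    also have "\<dots> \<in> N" by (induction p) (auto intro: N0 Nadd NZ that)
    finally show ?thesis .
  qed
  define P where "P = (\<Sum>j\<in>A. Polynomial.monom (a j) j)"
  have cP: "Polynomial.coeff P j = (if j \<in> A then a j else 0)" for j
    using finA by (simp add: P_def coeff_sum)
  have pP: "poly P w = (\<Sum>j\<in>A. a j * w ^ j)" for w
    by (simp add: P_def poly_sum poly_monom)
  have aN: "a j \<in> N" if j: "j \<in> A" for j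
  proof -
    obtain V where V: "V \<subseteq> W" "card V = card A" "finite V"
      using obtain_subset_with_card_n[OF W(3)] by blast
    define B where "B = int ` (A - {j})"
    define q where "q k = (\<Prod>b\<in>B. int k - b)" for k
    have "finite B" "Suc (card B) = card A"
      using finA j card_Suc_Diff1[OF finA j] by (auto simp: B_def card_image)
    hence kq: "diff_vanishes (card V) q" using diff_vanishes_prod[of B] V by (simp add: q_def[abs_def])
    have "(\<Sum>k<p. Polynomial.coeff P k * of_int (q k)) \<in> N"
    proof (rule moment_mem[where M = M and N = N and Z = "range (\<lambda>k. z ^ k)" and W = V])
      show "Polynomial.coeff P k \<in> M" for k
        unfolding cP M_def using adjoin_span_gen[OF finA] adjoin_span_0 by auto
      show "w * x \<in> M" if "w \<in> range (\<lambda>k. z ^ k)" "x \<in> M" for w x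
        using that unfolding M_def by (auto intro!: adjoin_span_mult int_adjoin_power int_adjoin_gen)
    qed (use A V W zero kq in \<open>auto simp: M_def[symmetric] cP pP N0 Nadd NZ Mint
           intro: adjoin_span_0[of z A a, folded M_def] adjoin_span_add[of _ z A a, folded M_def]\<close>)
    also have "(\<Sum>k<p. Polynomial.coeff P k * of_int (q k)) = (\<Sum>k\<in>{j}. Polynomial.coeff P k * of_int (q k))"
      using A j \<open>finite B\<close> finA
      by (intro sum.mono_neutral_right) (auto simp: cP q_def B_def prod_zero_iff)
    also have "\<dots> = of_int (q j) * a j" using j by (simp add: cP)
    finally have qN: "of_int (q j) * a j \<in> N" .
    \<comment> \<open>modulo \<open>N\<close> the coefficient is killed both by \<open>q j\<close> and by \<open>p\<close>, which are coprime\<close>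
    have "\<not> int p dvd q j"
    proof
      assume "int p dvd q j"
      then obtain b where b: "b \<in> B" "int p dvd int j - b"
        unfolding q_def using p \<open>finite B\<close> by (subst (asm) prime_dvd_prod_iff) auto
      then obtain k where "k \<in> A" "k \<noteq> j" "int p dvd int j - int k" by (auto simp: B_def)
      moreover have "j < p" "k < p" using A j \<open>k \<in> A\<close> by auto
      ultimately show False using zdvd_imp_le[of "int p" "\<bar>int j - int k\<bar>"] by auto
    qed
    hence "coprime (int p) (q j)" using p by (simp add: prime_imp_coprime)
    then obtain u v where uv: "u * int p + v * q j = 1"
      by (metis cong_def bezout_int coprime_imp_gcd_eq_1)
    have "a j = of_int (u * int p + v * q j) * a j" unfolding uv by simp
    also have "\<dots> = of_int u * (of_nat p * a j) + of_int v * (of_int (q j) * a j)"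
      by (simp add: algebra_simps)
    also have "\<dots> \<in> N"
      by (rule Nadd[OF Nmult[OF pN] Nmult[OF qN]])
        (auto intro: int_adjoin_int adjoin_span_gen[OF finA j] simp: M_def)
    finally show ?thesis .
  qed
  have MN: "x \<in> N" if x: "x \<in> M" for x
  proof -
    obtain r where r: "x = (\<Sum>j\<in>A. r j * a j)" "\<forall>j. r j \<in> int_adjoin z"
      using x unfolding adjoin_span_def M_def by auto
    have "B \<subseteq> A \<Longrightarrow> (\<Sum>j\<in>B. r j * a j) \<in> N" for B
      by (induction B rule: infinite_finite_induct) (auto intro!: N0 Nadd Nmult aN simp: r)
    thus ?thesis using r by auto
  qed
  have iter: "\<exists>y\<in>M. x = (1 - z) ^ k * y" if "x \<in> M" for x k
  proof (induction k)
    case (Suc k)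
    then obtain y where "y \<in> M" "x = (1 - z) ^ k * y" by auto
    with MN[of y] show ?case by (auto simp: N_def)
  qed (use that in auto)
  show ?thesis
  proof (rule adjoin_span_not_divisible[OF _ z(1) finA _ i])
    show "1 < p" using p prime_gt_1_nat by auto
    fix x assume "x \<in> adjoin_span z A a"
    then obtain y where y: "y \<in> M" "x = (1 - z) ^ p * y" using iter by (auto simp: M_def)
    obtain u where "u \<in> int_adjoin z" "(1 - z) ^ p = of_nat p * u"
      using prime_dvd_uniformizer_power[OF p z(1)] by auto
    thus "\<exists>y\<in>adjoin_span z A a. x = of_nat p * y"
      using y adjoin_span_mult[of y z A a u]
      by (intro bexI[of _ "u * y"]) (auto simp: M_def mult.assoc)
  qed
qed

section \<open>Exponential sums over a prime field\<close>

text \<open>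
  The representative of a residue class in \<open>{0..<p}\<close>.
\<close>

definition residue :: "'p::prime_card mod_ring \<Rightarrow> nat" where
  "residue x = nat (to_int_mod_ring x)"

text \<open>
  The additive character \<open>x \<mapsto> exp(2\<pi>ix/p)\<close>.
\<close>

definition add_char :: "'p::prime_card mod_ring \<Rightarrow> complex" where
  "add_char x = cis (2 * pi / CARD('p)) ^ residue x"

lemma residue_less: "residue (x :: 'p::prime_card mod_ring) < CARD('p)"
proof -
  have "to_int_mod_ring x \<in> {0..<int CARD('p)}"
    using range_to_int_mod_ring[where 'a = 'p] by blast
  thus ?thesis by (auto simp: residue_def)
qed

lemma of_nat_residue [simp]: "of_nat (residue x) = (x :: 'p::prime_card mod_ring)"
proof -
  have "to_int_mod_ring x \<in> {0..<int CARD('p)}"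
    using range_to_int_mod_ring[where 'a = 'p] by blast
  thus ?thesis by (auto simp: residue_def of_nat_of_int_mod_ring)
qed

lemma inj_residue: "inj residue"
  by (metis injI of_nat_residue)

lemma residue_of_nat: "residue (of_nat n :: 'p::prime_card mod_ring) = n mod CARD('p)"
proof -
  have "of_nat n = (of_nat (n mod CARD('p)) :: 'p mod_ring)"
    using of_nat_mod_CHAR[of n, where 'a = "'p mod_ring"] by simp
  also have "residue \<dots> = n mod CARD('p)"
    unfolding residue_def of_nat_of_int_mod_ring comp_apply by (subst to_int_mod_ring_of_int_mod_ring) auto
  finally show ?thesis .
qed

lemma primitive_root_power: "n > 0 \<Longrightarrow> cis (2 * pi / real n) ^ n = 1"
  by (simp add: Complex.DeMoivre)

lemma primitive_root_power_eq_1: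
  assumes "0 < k" "k < n"
  shows "cis (2 * pi / real n) ^ k \<noteq> 1"
proof
  assume "cis (2 * pi / real n) ^ k = 1"
  hence "cis (2 * pi * (real k / real n)) = 1" by (simp add: Complex.DeMoivre mult_ac)
  hence "cos (2 * pi * (real k / real n)) = 1" by (metis cis.simps(1) one_complex.simps(1))
  then obtain m :: int where "2 * pi * (real k / real n) = of_int m * 2 * pi"
    by (auto simp: cos_one_2pi_int)
  hence "real k = real_of_int m * real n" using assms by (simp add: field_simps)
  hence "int k = m * int n" by (metis of_int_eq_iff of_int_mult of_int_of_nat_eq)
  thus False using assms by (metis dvd_triv_right less_le_not_le of_nat_0_less_iff of_nat_less_iff zdvd_imp_le)
qed

lemma add_char_of_nat: "add_char (of_nat n :: 'p::prime_card mod_ring) = cis (2 * pi / CARD('p)) ^ n"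
proof -
  define z where "z = cis (2 * pi / CARD('p))"
  have "z ^ CARD('p) = 1" unfolding z_def by (rule primitive_root_power) simp
  hence "z ^ n = z ^ (n mod CARD('p))"
    by (metis mod_mult_div_eq mult.right_neutral power_add power_mult power_one)
  thus ?thesis by (simp add: add_char_def residue_of_nat z_def)
qed

lemma add_char_0 [simp]: "add_char 0 = 1"
  using add_char_of_nat[of 0] by simp

lemma add_char_add: "add_char (x + y) = add_char x * add_char (y :: 'p::prime_card mod_ring)"
proof -
  have "add_char (of_nat (residue x + residue y) :: 'p mod_ring) = add_char (of_nat (residue x) :: 'p mod_ring) * add_char (of_nat (residue y) :: 'p mod_ring)"
    unfolding add_char_of_nat by (rule power_add)
  thus ?thesis by simp
qed

lemma add_char_of_nat_mult: "add_char (of_nat n * x) = add_char (x :: 'p::prime_card mod_ring) ^ n"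
proof -
  have "add_char (of_nat (n * residue x) :: 'p mod_ring) = add_char (of_nat (residue x) :: 'p mod_ring) ^ n"
    unfolding add_char_of_nat by (simp add: power_mult[symmetric] mult.commute)
  thus ?thesis by simp
qed

lemma add_char_mult: "add_char (y * x) = add_char x ^ residue y"
  using add_char_of_nat_mult[of "residue y" x] by simp

lemma norm_add_char [simp]: "norm (add_char x) = 1"
  by (simp add: add_char_def norm_power)

lemma add_char_nonzero [simp]: "add_char x \<noteq> 0"
  using norm_add_char[of x] by (metis norm_zero zero_neq_one)

lemma add_char_minus: "add_char (- x) = inverse (add_char x)"
  using add_char_add[of x "- x"] by (simp add: field_simps)

lemma cnj_add_char: "cnj (add_char x) = add_char (- x)"
  unfolding add_char_minus by (simp add: add_char_def cis_cnj power_inverse flip: cis_inverse)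

lemma add_char_eq_1_iff: "add_char (x :: 'p::prime_card mod_ring) = 1 \<longleftrightarrow> x = 0"
proof
  assume *: "add_char x = 1"
  show "x = 0"
  proof (rule ccontr)
    assume "x \<noteq> 0"
    hence "residue x > 0" by (metis of_nat_0 of_nat_residue gr0I)
    thus False using * primitive_root_power_eq_1[OF _ residue_less[of x]] by (simp add: add_char_def)
  qed
qed simp

lemma inj_add_char: "inj (add_char :: 'p::prime_card mod_ring \<Rightarrow> complex)"
proof (rule injI)
  fix x y :: "'p mod_ring"
  assume "add_char x = add_char y"
  hence "add_char (x - y) = 1" using add_char_add[of x "- y"] by (simp add: add_char_minus)
  thus "x = y" by (simp add: add_char_eq_1_iff)
qed

lemma sum_add_char:
  "(\<Sum>x\<in>UNIV. add_char (a * x)) = (if a = 0 then of_nat CARD('p) else 0)"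
  for a :: "'p::prime_card mod_ring"
proof (cases "a = 0")
  case False
  have "(\<Sum>x\<in>UNIV. add_char (a * x)) = (\<Sum>x\<in>UNIV. add_char (a * (x + 1)))"
    by (rule sum.reindex_bij_witness[of _ "\<lambda>x. x + 1" "\<lambda>x. x - 1"]) auto
  also have "\<dots> = add_char a * (\<Sum>x\<in>UNIV. add_char (a * x))"
    by (simp add: distrib_left add_char_add sum_distrib_left mult.commute)
  finally have "(1 - add_char a) * (\<Sum>x\<in>UNIV. add_char (a * x)) = 0" by (simp add: algebra_simps)
  thus ?thesis using False add_char_eq_1_iff[of a] by auto
qed simp

lemma exponential_sum_zeros:
  fixes a :: "'p::prime_card mod_ring \<Rightarrow> complex"
  assumes "y \<in> A" "a y \<noteq> 0"
  shows "card {t. (\<Sum>y\<in>A. a y * add_char (y * t)) = 0} < card A"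
proof (rule ccontr)
  assume *: "\<not> ?thesis"
  define T where "T = {t. (\<Sum>y\<in>A. a y * add_char (y * t)) = 0}"
  define z where "z = cis (2 * pi / CARD('p))"
  have cA: "card (residue ` A) = card A" by (intro card_image inj_on_subset[OF inj_residue]) auto
  have cT: "card (add_char ` T) = card T" by (intro card_image inj_on_subset[OF inj_add_char]) auto
  have p: "prime CARD('p)" by (rule prime_card)
  have inv: "the_inv residue (residue x) = x" for x :: "'p mod_ring"
    by (rule the_inv_f_f[OF inj_residue])
  have "a (the_inv residue (residue y)) = 0"
  proof (rule sparse_polynomial_roots_of_unity[OF p, of z "residue ` A" "add_char ` T" "\<lambda>j. a (the_inv residue j)"])
    show "z ^ CARD('p) = 1" unfolding z_def by (rule primitive_root_power) simp
    show "z \<noteq> 1" using primitive_root_power_eq_1[of 1 "CARD('p)"] prime_gt_1_nat[OF p] by (simp add: z_def)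
    show "add_char ` T \<subseteq> range (\<lambda>k. z ^ k)" by (auto simp: add_char_def z_def)
    show "card (residue ` A) \<le> card (add_char ` T)" using * cA cT by (simp add: T_def)
    fix w assume "w \<in> add_char ` T"
    then obtain t where t: "t \<in> T" "w = add_char t" by auto
    have "(\<Sum>j\<in>residue ` A. a (the_inv residue j) * w ^ j) = (\<Sum>y\<in>A. a y * add_char (y * t))"
      by (subst sum.reindex) (auto simp: inv add_char_mult t inj_on_subset[OF inj_residue])
    thus "(\<Sum>j\<in>residue ` A. a (the_inv residue j) * w ^ j) = 0" using t by (simp add: T_def)
  qed (use assms residue_less in auto)
  thus False using assms by (simp add: inv)
qed

section \<open>The Fourier transform on the plane\<close>

text \<open>
  The standard bilinear form on the plane.
\<close>

definition dot :: "'a::comm_ring \<times> 'a \<Rightarrow> 'a \<times> 'a \<Rightarrow> 'a" where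
  "dot a x = fst a * fst x + snd a * snd x"

lemma dot_add_right: "dot a (x + y) = dot a x + dot a y"
  and dot_add_left: "dot (a + b) x = dot a x + dot b x"
  and dot_minus_right: "dot a (- x) = - dot a x"
  by (simp_all add: dot_def algebra_simps)

text \<open>
  The Fourier transform on the plane, with the dual group identified with the plane, without
  normalisation and without the customary minus sign in the exponent; neither affects supports up
  to the choice of the identification.
\<close>

definition fhat :: "('p::prime_card mod_ring \<times> 'p mod_ring \<Rightarrow> complex) \<Rightarrow>
    'p mod_ring \<times> 'p mod_ring \<Rightarrow> complex" where
  "fhat f a = (\<Sum>x\<in>UNIV. f x * add_char (dot a x))"

text \<open>
  The support of a function on a type.
\<close>

definition supp :: "('a \<Rightarrow> complex) \<Rightarrow> 'a set" where
  "supp f = {x. f x \<noteq> 0}"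

lemma sum_UNIV_prod: "(\<Sum>x\<in>UNIV. g x) = (\<Sum>c\<in>UNIV. \<Sum>y\<in>UNIV. g (c, y))"
  for g :: "'a::finite \<times> 'b::finite \<Rightarrow> 'c::comm_monoid_add"
  by (subst sum.cartesian_product) simp

lemma sum_add_char_dot:
  "(\<Sum>x\<in>UNIV. add_char (dot a x)) = (if a = 0 then of_nat CARD('p) ^ 2 else 0)"
  for a :: "'p::prime_card mod_ring \<times> 'p mod_ring"
proof -
  have "(\<Sum>x\<in>UNIV. add_char (dot a x)) =
      (\<Sum>c\<in>UNIV. add_char (fst a * c)) * (\<Sum>y\<in>UNIV. add_char (snd a * y))"
    unfolding sum_UNIV_prod sum_product by (simp add: dot_def add_char_add)
  thus ?thesis by (auto simp: sum_add_char prod_eq_iff power2_eq_square)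
qed

lemma fhat_fhat: "fhat (fhat f) x = of_nat CARD('p) ^ 2 * f (- x)"
  for f :: "'p::prime_card mod_ring \<times> 'p mod_ring \<Rightarrow> complex"
proof -
  have "fhat (fhat f) x = (\<Sum>a\<in>UNIV. \<Sum>y\<in>UNIV. f y * add_char (dot (y + x) a))"
    unfolding fhat_def sum_distrib_right
    by (intro sum.cong refl) (simp add: dot_def algebra_simps flip: add_char_add)
  also have "\<dots> = (\<Sum>y\<in>UNIV. f y * (\<Sum>a\<in>UNIV. add_char (dot (y + x) a)))"
    by (subst sum.swap) (simp add: sum_distrib_left)
  also have "\<dots> = (\<Sum>y\<in>UNIV. if y = - x then f y * of_nat CARD('p) ^ 2 else 0)"
    unfolding sum_add_char_dot by (intro sum.cong) (auto simp: eq_neg_iff_add_eq_0)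
  finally show ?thesis by (simp add: mult.commute)
qed

lemma bij_linear_pair:
  fixes a b :: "'p::prime_card mod_ring \<times> 'p mod_ring"
  assumes "fst a * snd b - snd a * fst b \<noteq> 0"
  shows "bij (\<lambda>x. (dot a x, dot b x))"
proof -
  have "inj (\<lambda>x. (dot a x, dot b x))"
  proof (rule injI)
    fix x y assume "(dot a x, dot b x) = (dot a y, dot b y)"
    hence *: "dot a x = dot a y" "dot b x = dot b y" by auto
    have "(fst a * snd b - snd a * fst b) * fst x = snd b * dot a x - snd a * dot b x"
         "(fst a * snd b - snd a * fst b) * fst y = snd b * dot a y - snd a * dot b y"
         "(fst a * snd b - snd a * fst b) * snd x = fst a * dot b x - fst b * dot a x"
         "(fst a * snd b - snd a * fst b) * snd y = fst a * dot b y - fst b * dot a y"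
      by (simp_all add: dot_def algebra_simps)
    thus "x = y" unfolding * using assms by (metis mult_cancel_left prod_eq_iff)
  qed
  thus ?thesis by (simp add: finite_UNIV_inj_surj bij_def)
qed

text \<open>
  A linear change of coordinates in the plane acts on the Fourier transform by the transposed change
  of coordinates, so it preserves the size of the Fourier support.
\<close>

lemma change_coordinates:
  fixes f :: "'p::prime_card mod_ring \<times> 'p mod_ring \<Rightarrow> complex"
  assumes "fst a * snd b - snd a * fst b \<noteq> 0"
  obtains f' where "\<And>x. f' (dot a x, dot b x) = f x" and "card (supp (fhat f')) = card (supp (fhat f))"
proof -
  define \<phi> where "\<phi> = (\<lambda>x. (dot a x, dot b x))"
  have bij: "bij \<phi>" unfolding \<phi>_def using assms by (rule bij_linear_pair)
  define f' where "f' = f \<circ> inv_into UNIV \<phi>"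
  have f': "f' (\<phi> x) = f x" for x by (simp add: f'_def inv_f_f[OF bij_is_inj[OF bij]])
  define \<psi> where "\<psi> = (\<lambda>u. (dot (fst a, fst b) u, dot (snd a, snd b) u))"
  have bij': "bij \<psi>" unfolding \<psi>_def by (rule bij_linear_pair) (use assms in \<open>simp add: mult.commute\<close>)
  have "fhat f' u = fhat f (\<psi> u)" for u
  proof -
    have "fhat f' u = (\<Sum>x\<in>UNIV. f' (\<phi> x) * add_char (dot u (\<phi> x)))"
      unfolding fhat_def by (rule sum.reindex_bij_betw[symmetric]) (rule bij)
    also have "\<dots> = (\<Sum>x\<in>UNIV. f x * add_char (dot (\<psi> u) x))"
      unfolding f' by (simp add: \<phi>_def \<psi>_def dot_def algebra_simps)
    finally show ?thesis by (simp add: fhat_def)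
  qed
  hence "supp (fhat f') = \<psi> -` supp (fhat f)" by (auto simp: supp_def)
  hence "card (supp (fhat f')) = card (supp (fhat f))"
    using bij' by (simp add: card_vimage_inj bij_is_inj bij_is_surj)
  thus ?thesis using that[of f'] f' by (simp add: \<phi>_def)
qed

text \<open>
  The Fourier transform in the second coordinate only.
\<close>

definition partial_fourier :: "('p::prime_card mod_ring \<times> 'p mod_ring \<Rightarrow> complex) \<Rightarrow>
    'p mod_ring \<Rightarrow> 'p mod_ring \<Rightarrow> complex" where
  "partial_fourier f t c = (\<Sum>y\<in>UNIV. f (c, y) * add_char (y * t))"

lemma fhat_partial_fourier:
  "fhat f (s, t) = (\<Sum>c\<in>UNIV. partial_fourier f t c * add_char (c * s))"
  unfolding fhat_def partial_fourier_def sum_UNIV_prod sum_distrib_right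
  by (intro sum.cong refl) (simp add: dot_def add_char_add mult.commute)

lemma partial_fourier_inversion:
  fixes f :: "'p::prime_card mod_ring \<times> 'p mod_ring \<Rightarrow> complex"
  shows "partial_fourier f t c = (\<Sum>s\<in>UNIV. fhat f (s, t) / of_nat CARD('p) * add_char (- s * c))"
proof -
  have "(\<Sum>s\<in>UNIV. fhat f (s, t) * add_char (- s * c)) =
     (\<Sum>s\<in>UNIV. \<Sum>d\<in>UNIV. partial_fourier f t d * add_char ((d - c) * s))"
    unfolding fhat_partial_fourier sum_distrib_right mult.assoc
    by (intro sum.cong refl) (simp add: algebra_simps flip: add_char_add)
  also have "\<dots> = (\<Sum>d\<in>UNIV. partial_fourier f t d * (\<Sum>s\<in>UNIV. add_char ((d - c) * s)))"
    by (subst sum.swap) (simp add: sum_distrib_left)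
  also have "\<dots> = (\<Sum>d\<in>UNIV. if d = c then of_nat CARD('p) * partial_fourier f t d else 0)"
    unfolding sum_add_char by (intro sum.cong) auto
  also have "\<dots> = of_nat CARD('p) * partial_fourier f t c" by simp
  finally show ?thesis by (simp add: field_simps flip: sum_divide_distrib)
qed

lemma card_Collect_prod:
  "card {(s, t). P s t} = (\<Sum>t\<in>UNIV. card {s. P s t})"
  for P :: "'a::finite \<Rightarrow> 'b::finite \<Rightarrow> bool"
proof -
  have "{(s, t). P s t} = prod.swap ` (SIGMA t:UNIV. {s. P s t})" by force
  thus ?thesis by (simp add: card_image)
qed

lemma sum_ge_card_mult:
  fixes h :: "'a::finite \<Rightarrow> nat"
  assumes "k \<le> card G" "\<And>s. s \<in> G \<Longrightarrow> v \<le> h s"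
  shows "k * v \<le> (\<Sum>s\<in>UNIV. h s)"
proof -
  have "k * v \<le> (\<Sum>s\<in>G. v)" using assms by simp
  also have "\<dots> \<le> (\<Sum>s\<in>G. h s)" by (rule sum_mono) (rule assms)
  also have "\<dots> \<le> (\<Sum>s\<in>UNIV. h s)" by (rule sum_mono2) auto
  finally show ?thesis .
qed

lemma card_Compl_eq: "card {x::'a::finite. \<not> P x} = CARD('a) - card {x. P x}"
  by (simp add: Collect_neg_eq card_Diff_subset Compl_eq_Diff_UNIV)

lemma exponential_sum_support:
  fixes a :: "'p::prime_card mod_ring \<Rightarrow> complex"
  assumes "a y \<noteq> 0" "card {y. a y \<noteq> 0} \<le> m"
  shows "CARD('p) + 1 - m \<le> card {t. (\<Sum>y\<in>UNIV. a y * add_char (y * t)) \<noteq> 0}"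
proof -
  have eq: "(\<Sum>y\<in>UNIV. a y * add_char (y * t)) = (\<Sum>y\<in>{y. a y \<noteq> 0}. a y * add_char (y * t))" for t
    by (rule sum.mono_neutral_right) auto
  have "card {t. (\<Sum>y\<in>UNIV. a y * add_char (y * t)) = 0} < card {y. a y \<noteq> 0}"
    unfolding eq by (rule exponential_sum_zeros) (use assms in auto)
  thus ?thesis using assms card_Compl_eq[of "\<lambda>t. (\<Sum>y\<in>UNIV. a y * add_char (y * t)) = 0"] by simp
qed

text \<open>
  For at least \<open>p + 1 - m\<close> values of \<open>t\<close> the partial Fourier transform is nonzero at \<open>(t, c)\<close>, and
  for each of these the slice of the Fourier support at height \<open>t\<close> has at least \<open>p + 1 - N\<close> points.
\<close>

lemma vertical_uncertainty:
  fixes f :: "'p::prime_card mod_ring \<times> 'p mod_ring \<Rightarrow> complex"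
  assumes "f (c, y) \<noteq> 0"
  shows "(CARD('p) + 1 - card {y. f (c, y) \<noteq> 0}) * (CARD('p) + 1 - card {c. \<exists>y. f (c, y) \<noteq> 0})
      \<le> card (supp (fhat f))"
proof -
  let ?N = "card {c. \<exists>y. f (c, y) \<noteq> 0}"
  have "supp (fhat f) = {(s, t). fhat f (s, t) \<noteq> 0}" by (auto simp: supp_def)
  hence X: "card (supp (fhat f)) = (\<Sum>t\<in>UNIV. card {s. fhat f (s, t) \<noteq> 0})"
    by (simp add: card_Collect_prod)
  have "CARD('p) + 1 - ?N \<le> card {s. fhat f (s, t) \<noteq> 0}" if t: "partial_fourier f t c \<noteq> 0" for t
    unfolding fhat_partial_fourier
  proof (rule exponential_sum_support)
    show "partial_fourier f t c \<noteq> 0" by fact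
    have "partial_fourier f t c = 0" if "\<forall>y. f (c, y) = 0" for c
      using that by (simp add: partial_fourier_def)
    thus "card {y. partial_fourier f t y \<noteq> 0} \<le> ?N" by (intro card_mono) auto
  qed
  moreover have "CARD('p) + 1 - card {y. f (c, y) \<noteq> 0} \<le> card {t. partial_fourier f t c \<noteq> 0}"
    unfolding partial_fourier_def by (rule exponential_sum_support) (use assms in auto)
  ultimately show ?thesis unfolding X
    by (intro sum_ge_card_mult[of _ "{t. partial_fourier f t c \<noteq> 0}"]) auto
qed

lemma transversal_exists:
  fixes a :: "'p::prime_card mod_ring \<times> 'p mod_ring"
  assumes "a \<noteq> 0"
  obtains b where "fst a * snd b - snd a * fst b \<noteq> 0"
proof (cases "fst a = 0")
  case True
  hence "snd a \<noteq> 0" using assms by (auto simp: prod_eq_iff)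
  thus ?thesis using True that[of "(1, 0)"] by simp
next
  case False
  thus ?thesis using that[of "(0, 1)"] by simp
qed

text \<open>
  Coordinates in which the level lines of the linear form \<open>dot a\<close> become vertical.
\<close>

lemma adapted_coordinates:
  fixes f :: "'p::prime_card mod_ring \<times> 'p mod_ring \<Rightarrow> complex"
  assumes "a \<noteq> 0"
  obtains f' where "card (supp (fhat f')) = card (supp (fhat f))"
    and "\<And>c. card {y. f' (c, y) \<noteq> 0} = card {x \<in> supp f. dot a x = c}"
    and "{c. \<exists>y. f' (c, y) \<noteq> 0} = dot a ` supp f"
proof -
  obtain b where b: "fst a * snd b - snd a * fst b \<noteq> 0" using transversal_exists[OF assms] .
  have bij: "bij (\<lambda>x. (dot a x, dot b x))" using b by (rule bij_linear_pair)
  obtain f' where f': "\<And>x. f' (dot a x, dot b x) = f x" "card (supp (fhat f')) = card (supp (fhat f))"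
    using change_coordinates[OF b] by metis
  have ex: "\<exists>x. c = dot a x \<and> y = dot b x" for c y
    using bij_is_surj[OF bij] by (metis (no_types, lifting) prod.inject surjE)
  have "card {y. f' (c, y) \<noteq> 0} = card {x \<in> supp f. dot a x = c}" for c
  proof -
    have "{y. f' (c, y) \<noteq> 0} = dot b ` {x \<in> supp f. dot a x = c}"
    proof (intro equalityI subsetI)
      fix y assume "y \<in> {y. f' (c, y) \<noteq> 0}"
      moreover obtain x where "c = dot a x" "y = dot b x" using ex[of c y] by (elim exE conjE)
      ultimately show "y \<in> dot b ` {x \<in> supp f. dot a x = c}"
        using f'(1)[of x] by (intro image_eqI[of _ _ x]) (simp_all add: supp_def)
    next
      fix y assume "y \<in> dot b ` {x \<in> supp f. dot a x = c}"
      then obtain x where x: "y = dot b x" "f x \<noteq> 0" "dot a x = c" by (auto simp: supp_def)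
      thus "y \<in> {y. f' (c, y) \<noteq> 0}" using f'(1)[of x] by simp
    qed
    moreover have "inj_on (dot b) {x \<in> supp f. dot a x = c}"
    proof (rule inj_onI)
      fix x y
      assume "x \<in> {x \<in> supp f. dot a x = c}" "y \<in> {x \<in> supp f. dot a x = c}" "dot b x = dot b y"
      thus "x = y" using injD[OF bij_is_inj[OF bij], of x y] by simp
    qed
    ultimately show ?thesis by (simp add: card_image)
  qed
  moreover have "{c. \<exists>y. f' (c, y) \<noteq> 0} = dot a ` supp f"
  proof (intro equalityI subsetI)
    fix c assume "c \<in> {c. \<exists>y. f' (c, y) \<noteq> 0}"
    then obtain y where "f' (c, y) \<noteq> 0" by auto
    moreover obtain x where "c = dot a x" "y = dot b x" using ex[of c y] by (elim exE conjE)
    ultimately show "c \<in> dot a ` supp f"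
      using f'(1)[of x] by (intro image_eqI[of _ _ x]) (simp_all add: supp_def)
  next
    fix c assume "c \<in> dot a ` supp f"
    then obtain x where "c = dot a x" "f x \<noteq> 0" by (auto simp: supp_def)
    thus "c \<in> {c. \<exists>y. f' (c, y) \<noteq> 0}" using f'(1)[of x] by (intro CollectI exI[of _ "dot b x"]) simp
  qed
  ultimately show ?thesis by (rule that[OF f'(2)])
qed

lemma directional_uncertainty:
  fixes f :: "'p::prime_card mod_ring \<times> 'p mod_ring \<Rightarrow> complex"
  assumes "a \<noteq> 0" "x \<in> supp f" "dot a x = c"
  shows "(CARD('p) + 1 - card {x \<in> supp f. dot a x = c}) * (CARD('p) + 1 - card (dot a ` supp f))
      \<le> card (supp (fhat f))"
proof -
  obtain f' where f': "card (supp (fhat f')) = card (supp (fhat f))"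
    "\<And>c. card {y. f' (c, y) \<noteq> 0} = card {x \<in> supp f. dot a x = c}"
    "{c. \<exists>y. f' (c, y) \<noteq> 0} = dot a ` supp f"
    by (rule adapted_coordinates[OF assms(1), of f], rule that)
  have "c \<in> {c. \<exists>y. f' (c, y) \<noteq> 0}" using assms f'(3) by auto
  then obtain y where "f' (c, y) \<noteq> 0" by auto
  from vertical_uncertainty[of f', OF this] show ?thesis by (simp add: f')
qed

section \<open>Lines with at least three points of the support\<close>

text \<open>
  Functions on \<open>\<F>\<^sub>p\<close> that are combinations of at most \<open>n\<close> additive characters.
\<close>

definition fourier_sparse :: "nat \<Rightarrow> ('p::prime_card mod_ring \<Rightarrow> complex) \<Rightarrow> bool" where
  "fourier_sparse n D \<longleftrightarrow> (\<exists>A w. card A \<le> n \<and> D = (\<lambda>c. \<Sum>z\<in>A. w z * add_char (z * c)))"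

lemma fourier_sparse_family:
  fixes \<theta> :: "'i \<Rightarrow> 'p::prime_card mod_ring"
  assumes "finite I"
  shows "fourier_sparse (card I) (\<lambda>c. \<Sum>i\<in>I. w i * add_char (\<theta> i * c))"
  unfolding fourier_sparse_def
proof (intro exI conjI)
  show "card (\<theta> ` I) \<le> card I" using assms by (rule card_image_le)
  show "(\<lambda>c. \<Sum>i\<in>I. w i * add_char (\<theta> i * c)) =
    (\<lambda>c. \<Sum>z\<in>\<theta> ` I. (\<Sum>i\<in>{i\<in>I. \<theta> i = z}. w i) * add_char (z * c))"
  proof
    fix c
    have "(\<Sum>z\<in>\<theta> ` I. (\<Sum>i\<in>{i\<in>I. \<theta> i = z}. w i) * add_char (z * c)) =
        (\<Sum>z\<in>\<theta> ` I. \<Sum>i\<in>{i\<in>I. \<theta> i = z}. w i * add_char (\<theta> i * c))"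
      by (simp add: sum_distrib_right)
    also have "\<dots> = (\<Sum>i\<in>I. w i * add_char (\<theta> i * c))"
      by (rule sum.group) (use assms in auto)
    finally show "(\<Sum>i\<in>I. w i * add_char (\<theta> i * c)) =
      (\<Sum>z\<in>\<theta> ` I. (\<Sum>i\<in>{i\<in>I. \<theta> i = z}. w i) * add_char (z * c))" ..
  qed
qed

lemma fourier_sparse_add:
  assumes "fourier_sparse m D" "fourier_sparse n E"
  shows "fourier_sparse (m + n) (\<lambda>c. D c + E c :: complex)"
proof -
  obtain A u where D: "card A \<le> m" "D = (\<lambda>c. \<Sum>z\<in>A. u z * add_char (z * c))"
    using assms(1) unfolding fourier_sparse_def by auto
  obtain B v where E: "card B \<le> n" "E = (\<lambda>c. \<Sum>z\<in>B. v z * add_char (z * c))"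
    using assms(2) unfolding fourier_sparse_def by auto
  have "fourier_sparse (card (A <+> B)) (\<lambda>c. \<Sum>i\<in>A <+> B. case_sum u v i * add_char (case_sum id id i * c))"
    by (rule fourier_sparse_family) simp
  moreover have "(\<Sum>i\<in>A <+> B. case_sum u v i * add_char (case_sum id id i * c)) = D c + E c" for c
    unfolding D E by (subst sum.Plus) simp_all
  moreover have "card (A <+> B) \<le> m + n" using D E by (simp add: card_Plus)
  ultimately show ?thesis unfolding fourier_sparse_def by (auto intro: le_trans)
qed

lemma fourier_sparse_mult:
  assumes "fourier_sparse m D" "fourier_sparse n E"
  shows "fourier_sparse (m * n) (\<lambda>c. D c * E c :: complex)"
proof -
  obtain A u where D: "card A \<le> m" "D = (\<lambda>c. \<Sum>z\<in>A. u z * add_char (z * c))"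
    using assms(1) unfolding fourier_sparse_def by auto
  obtain B v where E: "card B \<le> n" "E = (\<lambda>c. \<Sum>z\<in>B. v z * add_char (z * c))"
    using assms(2) unfolding fourier_sparse_def by auto
  have "fourier_sparse (card (A \<times> B)) (\<lambda>c. \<Sum>i\<in>A \<times> B. (u (fst i) * v (snd i)) * add_char ((fst i + snd i) * c))"
    by (rule fourier_sparse_family) simp
  moreover have "(\<Sum>i\<in>A \<times> B. (u (fst i) * v (snd i)) * add_char ((fst i + snd i) * c)) = D c * E c" for c
    unfolding D E sum_product sum.cartesian_product
    by (intro sum.cong refl) (auto simp: distrib_right add_char_add)
  moreover have "card (A \<times> B) \<le> m * n" using D E by (simp add: card_cartesian_product mult_le_mono)
  ultimately show ?thesis unfolding fourier_sparse_def by (auto intro: le_trans)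
qed

lemma fourier_sparse_uminus:
  assumes "fourier_sparse n D" shows "fourier_sparse n (\<lambda>c. - D c :: complex)"
proof -
  obtain A u where D: "card A \<le> n" "D = (\<lambda>c. \<Sum>z\<in>A. u z * add_char (z * c))"
    using assms(1) unfolding fourier_sparse_def by auto
  show ?thesis unfolding fourier_sparse_def
    by (intro exI[of _ A] exI[of _ "\<lambda>z. - u z"]) (simp add: D sum_negf)
qed

lemma fourier_sparse_zeros:
  assumes "fourier_sparse n D" "D c \<noteq> 0"
  shows "card {c. D c = 0} < n"
proof -
  obtain A u where D: "card A \<le> n" "D = (\<lambda>c. \<Sum>z\<in>A. u z * add_char (z * c))"
    using assms(1) unfolding fourier_sparse_def by auto
  obtain z where z: "z \<in> A" "u z * add_char (z * c) \<noteq> 0"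
    using assms(2) unfolding D(2) by (rule sum.not_neutral_contains_not_neutral)
  hence "u z \<noteq> 0" by auto
  from exponential_sum_zeros[of z A u, OF z(1) this] show ?thesis using D by simp
qed

lemma fourier_sparse_partial_fourier:
  fixes f :: "'p::prime_card mod_ring \<times> 'p mod_ring \<Rightarrow> complex"
  shows "fourier_sparse (card {s. fhat f (s, t) \<noteq> 0}) (partial_fourier f t)"
proof -
  have "partial_fourier f t =
    (\<lambda>c. \<Sum>s\<in>{s. fhat f (s, t) \<noteq> 0}. fhat f (s, t) / of_nat CARD('p) * add_char (- s * c))"
    by (rule ext, subst partial_fourier_inversion, rule sum.mono_neutral_right) auto
  thus ?thesis using fourier_sparse_family[of "{s. fhat f (s, t) \<noteq> 0}" "\<lambda>s. fhat f (s, t) / of_nat CARD('p)" "\<lambda>s. - s"]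
    by simp
qed

text \<open>
  The determinant of the three by three matrix with rows \<open>(h r, h (r + 1), h (r + 2))\<close>,
  \<open>(h s, h (s + 1), h (s + 2))\<close> and \<open>(h t, h (t + 1), h (t + 2))\<close>, as a sum of six products.
\<close>

definition window_det :: "('a::comm_ring_1 \<Rightarrow> 'b::comm_ring) \<Rightarrow> 'a \<Rightarrow> 'a \<Rightarrow> 'a \<Rightarrow> 'b" where
  "window_det h r s t =
     (h r * h (s + 1) * h (t + 2) + h (r + 1) * h (s + 2) * h t + h (r + 2) * h s * h (t + 1))
   + - (h (r + 2) * h (s + 1) * h t + h (r + 1) * h s * h (t + 2) + h r * h (s + 2) * h (t + 1))"

text \<open>
  An exponential sum with at most two frequencies satisfies a linear recurrence of order two, so
  its determinants vanish.
\<close>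

lemma window_det_two_terms:
  fixes g :: "'p::prime_card mod_ring \<Rightarrow> complex"
  assumes "card {y. g y \<noteq> 0} \<le> 2"
  shows "window_det (\<lambda>t. \<Sum>y\<in>UNIV. g y * add_char (y * t)) r s t = 0"
proof -
  have "\<exists>y z. {y. g y \<noteq> 0} \<subseteq> {y, z}"
  proof -
    consider "card {y. g y \<noteq> 0} = 0" | "card {y. g y \<noteq> 0} = 1" | "card {y. g y \<noteq> 0} = 2"
      using assms by linarith
    thus ?thesis
    proof cases
      case 1
      thus ?thesis by simp
    next
      case 2
      thus ?thesis by (metis card_1_singletonE insert_absorb2 order_refl)
    next
      case 3
      thus ?thesis by (metis card_2_iff order_refl)
    qed
  qed
  then obtain y z where yz: "{y. g y \<noteq> 0} \<subseteq> {y, z}" by auto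
  define \<alpha> \<beta> where "\<alpha> = g y" and "\<beta> = (if z = y then 0 else g z)"
  have h: "(\<Sum>y\<in>UNIV. g y * add_char (y * t)) = \<alpha> * add_char (y * t) + \<beta> * add_char (z * t)" for t
  proof -
    have "(\<Sum>y\<in>UNIV. g y * add_char (y * t)) = (\<Sum>y\<in>{y, z}. g y * add_char (y * t))"
      by (rule sum.mono_neutral_right) (use yz in auto)
    thus ?thesis by (auto simp: \<alpha>_def \<beta>_def)
  qed
  define P Q where "P = add_char y" and "Q = add_char z"
  have 1: "add_char (y * (x + 1)) = add_char (y * x) * P" "add_char (z * (x + 1)) = add_char (z * x) * Q"
    "add_char (y * (x + 2)) = add_char (y * x) * (P * P)" "add_char (z * (x + 2)) = add_char (z * x) * (Q * Q)" for x
    by (simp_all add: P_def Q_def distrib_left mult_2_right flip: add_char_add)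
  show ?thesis unfolding window_det_def h 1 by (simp add: algebra_simps)
qed

lemma quadratic_roots:
  fixes A B C :: "'a::idom"
  assumes "A \<noteq> 0"
  shows "card {x. A * x ^ 2 + B * x + C = 0} \<le> 2" "finite {x. A * x ^ 2 + B * x + C = 0}"
proof -
  have *: "{x. A * x ^ 2 + B * x + C = 0} = {x. poly [:C, B, A:] x = 0}"
    by (auto simp: algebra_simps power2_eq_square)
  have "[:C, B, A:] \<noteq> 0" using assms by simp
  from card_poly_roots_bound[OF this] poly_roots_finite[OF this]
  show "card {x. A * x ^ 2 + B * x + C = 0} \<le> 2" "finite {x. A * x ^ 2 + B * x + C = 0}"
    unfolding * using assms by auto
qed

text \<open>
  A combination of shifts of an exponential sum has the same frequencies, with coefficients
  multiplied by the values of a quadratic polynomial at \<open>add_char y\<close>.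
\<close>

lemma shifted_combination_support:
  fixes g :: "'p::prime_card mod_ring \<Rightarrow> complex"
  defines "h \<equiv> \<lambda>t. \<Sum>y\<in>UNIV. g y * add_char (y * t)"
  assumes "card {y. g y \<noteq> 0} = m" "\<exists>y. g y \<noteq> 0 \<and> A * add_char y ^ 2 + B * add_char y + C \<noteq> 0"
  shows "CARD('p) + 1 - m \<le> card {t. A * h (t + 2) + B * h (t + 1) + C * h t \<noteq> 0}"
proof -
  obtain y where y: "g y \<noteq> 0" "A * add_char y ^ 2 + B * add_char y + C \<noteq> 0" using assms by auto
  define g' where "g' y = g y * (A * add_char y ^ 2 + B * add_char y + C)" for y
  have e: "add_char (y * (t + 2)) = add_char (y * t) * add_char y ^ 2"
    "add_char (y * (t + 1)) = add_char (y * t) * add_char y" for y t :: "'p mod_ring"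
    by (simp_all add: distrib_left mult_2_right power2_eq_square mult.assoc flip: add_char_add)
  have "A * h (t + 2) + B * h (t + 1) + C * h t = (\<Sum>y\<in>UNIV. g' y * add_char (y * t))" for t
    unfolding h_def g'_def sum_distrib_left sum.distrib[symmetric]
    by (intro sum.cong refl) (simp only: e, simp add: algebra_simps)
  moreover have "card {y. g' y \<noteq> 0} \<le> card {y. g y \<noteq> 0}"
    by (rule card_mono) (auto simp: g'_def)
  ultimately show ?thesis
    using exponential_sum_support[of g' y m] y assms(2) by (simp add: g'_def)
qed

lemma quadratic_nonvanishing:
  fixes g :: "'p::prime_card mod_ring \<Rightarrow> complex"
  assumes "card {y. g y \<noteq> 0} \<ge> 3" "A \<noteq> 0 \<or> B \<noteq> 0 \<or> C \<noteq> 0"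
  shows "\<exists>y. g y \<noteq> 0 \<and> A * add_char y ^ 2 + B * add_char y + C \<noteq> 0"
proof (rule ccontr)
  assume "\<not> ?thesis"
  hence sub: "add_char ` {y. g y \<noteq> 0} \<subseteq> {x. A * x ^ 2 + B * x + C = 0}" by auto
  have fin: "card {x. A * x ^ 2 + B * x + C = 0} \<le> 2 \<and> finite {x. A * x ^ 2 + B * x + C = 0}"
  proof (cases "A = 0")
    case False
    thus ?thesis using quadratic_roots by blast
  next
    case True
    have "{x. A * x ^ 2 + B * x + C = 0} \<subseteq> {- C / B}"
    proof
      fix x assume "x \<in> {x. A * x ^ 2 + B * x + C = 0}"
      hence *: "B * x = - C" using True by (simp add: eq_neg_iff_add_eq_0)
      hence "B \<noteq> 0" using assms(2) True by auto
      thus "x \<in> {- C / B}" using * by (simp add: field_simps)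
    qed
    moreover from card_mono[OF _ this] have "card {x. A * x ^ 2 + B * x + C = 0} \<le> 1" by simp
    ultimately show ?thesis using finite_subset by auto
  qed
  have "card {y. g y \<noteq> 0} = card (add_char ` {y. g y \<noteq> 0})"
    by (rule card_image[symmetric]) (rule inj_on_subset[OF inj_add_char], simp)
  also have "\<dots> \<le> 2" using card_mono[OF _ sub] fin by linarith
  finally show False using assms(1) by simp
qed

text \<open>
  For an exponential sum with \<open>m \<ge> 3\<close> frequencies at least \<open>(p + 1 - m)\<^sup>3\<close> determinants are nonzero.
  The arguments \<open>r\<close>, \<open>s\<close>, \<open>t\<close> are chosen one after the other so that the leading minors of order
  one, two and three do not vanish; expanding a minor along its last row gives a combination of
  shifts, whose zeros are few because a nonzero polynomial of degree at most two cannot vanish at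
  the \<open>m\<close> points \<open>add_char y\<close>.
\<close>

lemma window_det_sum_bound:
  fixes g :: "'p::prime_card mod_ring \<Rightarrow> complex" and v :: "'p mod_ring \<Rightarrow> 'p mod_ring \<Rightarrow> 'p mod_ring \<Rightarrow> nat"
  defines "h \<equiv> \<lambda>t. \<Sum>y\<in>UNIV. g y * add_char (y * t)"
  assumes m: "card {y. g y \<noteq> 0} = m" "m \<ge> 3"
    and v: "\<And>r s t. window_det h r s t \<noteq> 0 \<Longrightarrow> z \<le> v r s t"
  shows "(CARD('p) + 1 - m) ^ 3 * z \<le> (\<Sum>r\<in>UNIV. \<Sum>s\<in>UNIV. \<Sum>t\<in>UNIV. v r s t)"
proof -
  let ?k = "CARD('p) + 1 - m"
  have *: "?k \<le> card {t. A * h (t + 2) + B * h (t + 1) + C * h t \<noteq> 0}"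
    if "A \<noteq> 0 \<or> B \<noteq> 0 \<or> C \<noteq> 0" for A B C
    unfolding h_def using m that by (intro shifted_combination_support quadratic_nonvanishing) auto
  have third: "?k * z \<le> (\<Sum>t\<in>UNIV. v r s t)" if "h r * h (s + 1) - h (r + 1) * h s \<noteq> 0" for r s
  proof (rule sum_ge_card_mult)
    let ?A = "h r * h (s + 1) - h (r + 1) * h s" and ?B = "h (r + 2) * h s - h r * h (s + 2)"
      and ?C = "h (r + 1) * h (s + 2) - h (r + 2) * h (s + 1)"
    show "?k \<le> card {t. ?A * h (t + 2) + ?B * h (t + 1) + ?C * h t \<noteq> 0}"
      using * that by blast
    fix t assume "t \<in> {t. ?A * h (t + 2) + ?B * h (t + 1) + ?C * h t \<noteq> 0}"
    moreover have "?A * h (t + 2) + ?B * h (t + 1) + ?C * h t = window_det h r s t"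
      by (simp add: window_det_def algebra_simps)
    ultimately show "z \<le> v r s t" using v by simp
  qed
  have second: "?k * (?k * z) \<le> (\<Sum>s\<in>UNIV. \<Sum>t\<in>UNIV. v r s t)" if "h r \<noteq> 0" for r
  proof (rule sum_ge_card_mult)
    show "?k \<le> card {s. 0 * h (s + 2) + h r * h (s + 1) + (- h (r + 1)) * h s \<noteq> 0}"
      by (rule *) (use that in simp)
  qed (use third in auto)
  have "?k * (?k * (?k * z)) \<le> (\<Sum>r\<in>UNIV. \<Sum>s\<in>UNIV. \<Sum>t\<in>UNIV. v r s t)"
  proof (rule sum_ge_card_mult)
    show "?k \<le> card {s. 0 * h (s + 2) + 0 * h (s + 1) + 1 * h s \<noteq> 0}"
      by (rule *) simp
  qed (use second in auto)
  thus ?thesis by (simp add: power3_eq_cube mult.assoc)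
qed

lemma sum_shift: "(\<Sum>x\<in>UNIV. n (x + a)) = (\<Sum>x\<in>UNIV. n x)"
  for n :: "'p::prime_card mod_ring \<Rightarrow> nat"
  by (rule sum.reindex_bij_witness[of _ "\<lambda>x. x - a" "\<lambda>x. x + a"]) auto

lemma sum_triple_product:
  fixes n :: "'p::prime_card mod_ring \<Rightarrow> nat"
  shows "(\<Sum>r\<in>UNIV. \<Sum>s\<in>UNIV. \<Sum>t\<in>UNIV. n (r + a) * n (s + b) * n (t + c)) = (\<Sum>x\<in>UNIV. n x) ^ 3"
  unfolding sum_distrib_left[symmetric] sum_distrib_right[symmetric] sum_shift
  by (simp add: power3_eq_cube)

text \<open>
  Here \<open>m\<close> is the number of points of the support on some vertical line. As a function of the
  vertical line, a determinant of the partial Fourier transforms is \<open>v r s t\<close>-sparse and vanishes on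
  all vertical lines with at most two points.
\<close>

lemma vertical_line_bound:
  fixes f :: "'p::prime_card mod_ring \<times> 'p mod_ring \<Rightarrow> complex"
  assumes "card {y. f (c, y) \<noteq> 0} = m" "m \<ge> 3"
  shows "(CARD('p) + 1 - m) ^ 3 * card {c. card {y. f (c, y) \<noteq> 0} \<le> 2} \<le> 6 * card (supp (fhat f)) ^ 3"
proof -
  define n where "n t = card {s. fhat f (s, t) \<noteq> 0}" for t
  define v where "v r s t =
     (n r * n (s + 1) * n (t + 2) + n (r + 1) * n (s + 2) * n t + n (r + 2) * n s * n (t + 1))
   + (n (r + 2) * n (s + 1) * n t + n (r + 1) * n s * n (t + 2) + n r * n (s + 2) * n (t + 1))" for r s t
  have "supp (fhat f) = {(s, t). fhat f (s, t) \<noteq> 0}" by (auto simp: supp_def)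
  hence X: "card (supp (fhat f)) = (\<Sum>t\<in>UNIV. n t)"
    by (simp add: card_Collect_prod n_def)
  have "(CARD('p) + 1 - m) ^ 3 * card {c. card {y. f (c, y) \<noteq> 0} \<le> 2} \<le> (\<Sum>r\<in>UNIV. \<Sum>s\<in>UNIV. \<Sum>t\<in>UNIV. v r s t)"
  proof (rule window_det_sum_bound[where g = "\<lambda>y. f (c, y)"])
    fix r s t
    define D where "D c = window_det (\<lambda>t. partial_fourier f t c) r s t" for c
    assume "window_det (\<lambda>t. \<Sum>y\<in>UNIV. f (c, y) * add_char (y * t)) r s t \<noteq> 0"
    hence nz: "D c \<noteq> 0" by (simp add: D_def partial_fourier_def)
    have "fourier_sparse (v r s t) D"
      unfolding D_def[abs_def] window_det_def v_def
      by (intro fourier_sparse_add fourier_sparse_mult fourier_sparse_uminus)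
        (simp_all add: n_def fourier_sparse_partial_fourier)
    hence "card {c. D c = 0} < v r s t" using nz by (rule fourier_sparse_zeros)
    moreover have "card {c. card {y. f (c, y) \<noteq> 0} \<le> 2} \<le> card {c. D c = 0}"
    proof (rule card_mono)
      show "{c. card {y. f (c, y) \<noteq> 0} \<le> 2} \<subseteq> {c. D c = 0}"
        unfolding D_def partial_fourier_def by (intro subsetI CollectI window_det_two_terms) simp
    qed simp
    ultimately show "card {c. card {y. f (c, y) \<noteq> 0} \<le> 2} \<le> v r s t" by simp
  qed (use assms in auto)
  also have "\<dots> = 6 * (\<Sum>t\<in>UNIV. n t) ^ 3"
    using sum_triple_product[of n 0 1 2] sum_triple_product[of n 1 2 0] sum_triple_product[of n 2 0 1]
      sum_triple_product[of n 2 1 0] sum_triple_product[of n 1 0 2] sum_triple_product[of n 0 2 1]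
    by (simp add: v_def sum.distrib)
  finally show ?thesis by (simp add: X)
qed

lemma line_bound:
  fixes f :: "'p::prime_card mod_ring \<times> 'p mod_ring \<Rightarrow> complex"
  assumes "a \<noteq> 0" "card {x \<in> supp f. dot a x = c} = m" "m \<ge> 3"
  shows "(CARD('p) + 1 - m) ^ 3 * card {c. card {x \<in> supp f. dot a x = c} \<le> 2} \<le> 6 * card (supp (fhat f)) ^ 3"
proof -
  obtain f' where f': "card (supp (fhat f')) = card (supp (fhat f))"
    "\<And>c. card {y. f' (c, y) \<noteq> 0} = card {x \<in> supp f. dot a x = c}"
    "{c. \<exists>y. f' (c, y) \<noteq> 0} = dot a ` supp f"
    by (rule adapted_coordinates[OF assms(1), of f], rule that)
  show ?thesis using vertical_line_bound[of f' c m] assms(2,3) by (simp add: f')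
qed

section \<open>Families of lines\<close>

text \<open>
  The level lines of a linear form, and the set of all lines of the plane, which excludes the zero
  form.
\<close>

definition affine_line :: "'a::comm_ring \<times> 'a \<Rightarrow> 'a \<Rightarrow> ('a \<times> 'a) set" where
  "affine_line a c = {x. dot a x = c}"

definition lines :: "('a::comm_ring \<times> 'a) set set" where
  "lines = {affine_line a c | a c. a \<noteq> 0}"

lemma line_through:
  fixes a :: "'a::field \<times> 'a"
  assumes "a \<noteq> 0" "x \<in> affine_line a c" "y \<in> affine_line a c" "x \<noteq> y"
  shows "affine_line a c = {z. fst (z - x) * snd (y - x) = snd (z - x) * fst (y - x)}"
proof -
  define d where "d = y - x"
  have d: "fst d \<noteq> 0 \<or> snd d \<noteq> 0" using assms(4) by (auto simp: d_def prod_eq_iff)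
  have a: "fst a \<noteq> 0 \<or> snd a \<noteq> 0" using assms(1) by (auto simp: prod_eq_iff)
  have ad: "dot a d = 0" using assms by (simp add: affine_line_def dot_def d_def algebra_simps)
  have "dot a e = 0 \<longleftrightarrow> fst e * snd d = snd e * fst d" for e
  proof -
    have 1: "snd a * snd d = - (fst a * fst d)" using ad by (simp add: dot_def eq_neg_iff_add_eq_0 add.commute)
    have "fst a * (fst e * snd d - snd e * fst d) = fst a * fst e * snd d + snd e * (- (fst a * fst d))"
      by (simp add: algebra_simps)
    also have "\<dots> = snd d * dot a e" unfolding 1[symmetric] by (simp add: dot_def algebra_simps)
    finally have 2: "fst a * (fst e * snd d - snd e * fst d) = snd d * dot a e" .
    have "snd a * (fst e * snd d - snd e * fst d) = fst e * (snd a * snd d) - snd a * snd e * fst d"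
      by (simp add: algebra_simps)
    also have "\<dots> = - fst d * dot a e" unfolding 1 by (simp add: dot_def algebra_simps)
    finally have 3: "snd a * (fst e * snd d - snd e * fst d) = - fst d * dot a e" .
    have "dot a e = 0 \<longleftrightarrow> fst e * snd d - snd e * fst d = 0"
      using 2 3 a d by (metis mult_eq_0_iff neg_equal_0_iff_equal)
    thus ?thesis by simp
  qed
  moreover have "z \<in> affine_line a c \<longleftrightarrow> dot a (z - x) = 0" for z
    using assms(2) by (auto simp: affine_line_def dot_def algebra_simps)
  ultimately show ?thesis by (auto simp: d_def)
qed

lemma card_line_Int:
  fixes l l' :: "('a::{field,finite} \<times> 'a) set"
  assumes "l \<in> lines" "l' \<in> lines" "l \<noteq> l'"
  shows "card (l \<inter> l') \<le> 1"
proof (rule ccontr)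
  assume "\<not> ?thesis"
  then obtain x y where xy: "x \<in> l \<inter> l'" "y \<in> l \<inter> l'" "x \<noteq> y"
    by (metis card_le_Suc0_iff_eq finite One_nat_def)
  obtain a c where l: "l = affine_line a c" "a \<noteq> 0" using assms unfolding lines_def by auto
  obtain a' c' where l': "l' = affine_line a' c'" "a' \<noteq> 0" using assms unfolding lines_def by auto
  have 1: "l = {z. fst (z - x) * snd (y - x) = snd (z - x) * fst (y - x)}"
    unfolding l(1) by (rule line_through) (use xy l in auto)
  have 2: "l' = {z. fst (z - x) * snd (y - x) = snd (z - x) * fst (y - x)}"
    unfolding l'(1) by (rule line_through) (use xy l' in auto)
  show False using assms(3) trans[OF 1 2[symmetric]] by blast
qed

lemma card_line_Int_Union:
  fixes l :: "('a::{field,finite} \<times> 'a) set"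
  assumes "l \<in> lines" "\<M> \<subseteq> lines" "l \<notin> \<M>"
  shows "card (l \<inter> \<Union>\<M>) \<le> card \<M>"
proof -
  have "card (l \<inter> \<Union>\<M>) = card (\<Union>l'\<in>\<M>. l \<inter> l')" by (rule arg_cong[where f = card]) auto
  also have "\<dots> \<le> (\<Sum>l'\<in>\<M>. card (l \<inter> l'))" by (rule card_UN_le) simp
  also have "\<dots> \<le> (\<Sum>l'\<in>\<M>. 1)" using assms by (intro sum_mono card_line_Int) auto
  finally show ?thesis by simp
qed

lemma card_Union_lines:
  fixes S :: "('a::{field,finite} \<times> 'a) set"
  assumes "\<M> \<subseteq> lines" "\<And>l. l \<in> \<M> \<Longrightarrow> m \<le> card (S \<inter> l)"
  shows "card \<M> * m \<le> card (S \<inter> \<Union>\<M>) + card \<M> ^ 2"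
proof -
  have "finite \<M>" by simp
  thus ?thesis using assms
  proof (induction \<M> rule: finite_induct)
    case (insert l \<M>)
    have "m \<le> card (S \<inter> l)" using insert.prems by simp
    also have "\<dots> \<le> card ((S \<inter> l - \<Union>\<M>) \<union> (l \<inter> \<Union>\<M>))" by (rule card_mono) auto
    also have "\<dots> \<le> card (S \<inter> l - \<Union>\<M>) + card (l \<inter> \<Union>\<M>)" by (rule card_Un_le)
    also have "card (l \<inter> \<Union>\<M>) \<le> card \<M>" using insert by (intro card_line_Int_Union) auto
    finally have 1: "m \<le> card (S \<inter> l - \<Union>\<M>) + card \<M>" by simp
    have "S \<inter> \<Union>(insert l \<M>) = (S \<inter> l - \<Union>\<M>) \<union> (S \<inter> \<Union>\<M>)" by auto
    hence "card (S \<inter> \<Union>(insert l \<M>)) = card (S \<inter> l - \<Union>\<M>) + card (S \<inter> \<Union>\<M>)"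
      by (simp add: card_Un_disjoint Int_Diff disjoint_iff)
    moreover have "card \<M> * m \<le> card (S \<inter> \<Union>\<M>) + card \<M> ^ 2" using insert by auto
    ultimately show ?case using insert.hyps 1 by (simp add: power2_eq_square)
  qed simp
qed

text \<open>
  Multiplication by \<open>1 - add_char (dot a x - c)\<close> deletes the line \<open>affine_line a c\<close> from the support
  and replaces the Fourier transform by a combination of itself and one translate.
\<close>

lemma remove_lines:
  fixes f :: "'p::prime_card mod_ring \<times> 'p mod_ring \<Rightarrow> complex"
  assumes "\<M> \<subseteq> lines"
  shows "\<exists>f'. supp f' = supp f - \<Union>\<M> \<and> card (supp (fhat f')) \<le> 2 ^ card \<M> * card (supp (fhat f))"
proof -
  have "finite \<M>" by simp
  thus ?thesis using assms
  proof (induction \<M> rule: finite_induct)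
    case empty
    show ?case by (intro exI[of _ f]) simp
  next
    case (insert l \<M>)
    then obtain f' where f': "supp f' = supp f - \<Union>\<M>" "card (supp (fhat f')) \<le> 2 ^ card \<M> * card (supp (fhat f))"
      by auto
    obtain a c where l: "l = affine_line a c" "a \<noteq> 0" using insert.prems unfolding lines_def by auto
    define g where "g x = f' x * (1 - add_char (dot a x - c))" for x
    have "supp g = supp f' - l" by (auto simp: supp_def g_def l affine_line_def add_char_eq_1_iff)
    hence "supp g = supp f - \<Union>(insert l \<M>)" using f' by auto
    moreover have "card (supp (fhat g)) \<le> 2 ^ card (insert l \<M>) * card (supp (fhat f))"
    proof -
      have "fhat g u = fhat f' u - add_char (- c) * fhat f' (u + a)" for u
        unfolding fhat_def g_def sum_distrib_left sum_subtractf[symmetric]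
        by (intro sum.cong refl) (simp add: dot_def algebra_simps flip: add_char_add)
      hence *: "fhat g u = 0" if "fhat f' u = 0" "fhat f' (u + a) = 0" for u
        using that by simp
      have "u \<in> supp (fhat f') \<union> (\<lambda>u. u - a) ` supp (fhat f')" if u: "u \<in> supp (fhat g)" for u
      proof (cases "fhat f' u = 0")
        case True
        hence "u + a \<in> supp (fhat f')" using *[of u] u by (auto simp: supp_def)
        thus ?thesis by (intro UnI2 image_eqI[of _ _ "u + a"]) simp_all
      qed (simp add: supp_def)
      hence "supp (fhat g) \<subseteq> supp (fhat f') \<union> (\<lambda>u. u - a) ` supp (fhat f')" by blast
      hence "card (supp (fhat g)) \<le> card (supp (fhat f') \<union> (\<lambda>u. u - a) ` supp (fhat f'))"
        by (intro card_mono) auto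
      also have "\<dots> \<le> card (supp (fhat f')) + card (supp (fhat f'))"
        by (rule order_trans[OF card_Un_le]) (simp add: card_image_le)
      finally show ?thesis using f'(2) insert.hyps by simp
    qed
    ultimately show ?case by blast
  qed
qed

text \<open>
  Both inequalities hold fibrewise: a fibre of size \<open>k \<in> {1, 2}\<close> contributes \<open>k\<^sup>2\<close> pairs, and
  \<open>2 + k\<^sup>2 \<le> 3k\<close> and \<open>k\<^sup>2 \<le> 2k\<close>.
\<close>

lemma small_fibres_pairs:
  fixes S :: "'a::finite set" and \<phi> :: "'a \<Rightarrow> 'b"
  assumes "\<And>x. x \<in> S \<Longrightarrow> card {y \<in> S. \<phi> y = \<phi> x} \<le> 2"
  shows "2 * card (\<phi> ` S) + card {(x, y) \<in> S \<times> S. \<phi> x = \<phi> y} \<le> 3 * card S"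
    and "card {(x, y) \<in> S \<times> S. \<phi> x = \<phi> y} \<le> 2 * card S"
proof -
  define F where "F c = {y \<in> S. \<phi> y = c}" for c
  have F: "card (F c) \<in> {1, 2}" if c: "c \<in> \<phi> ` S" for c
  proof -
    obtain x where x: "x \<in> S" "c = \<phi> x" using c by auto
    hence "x \<in> F c" by (auto simp: F_def)
    hence "card (F c) > 0" by (auto simp: card_gt_0_iff)
    thus ?thesis using assms[OF x(1)] x by (auto simp: F_def)
  qed
  have S: "card S = (\<Sum>c\<in>\<phi> ` S. card (F c))"
    unfolding F_def using sum.image_gen[of S "\<lambda>_. 1 :: nat" \<phi>] by simp
  have eq: "{(x, y) \<in> S \<times> S. \<phi> x = \<phi> y} = (\<Union>c\<in>\<phi> ` S. F c \<times> F c)"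
    by (auto simp: F_def)
  have pairs: "card {(x, y) \<in> S \<times> S. \<phi> x = \<phi> y} = (\<Sum>c\<in>\<phi> ` S. card (F c) ^ 2)"
    unfolding eq by (subst card_UN_disjoint) (auto simp: F_def card_cartesian_product power2_eq_square)
  have "2 * card (\<phi> ` S) + card {(x, y) \<in> S \<times> S. \<phi> x = \<phi> y} = (\<Sum>c\<in>\<phi> ` S. 2 + card (F c) ^ 2)"
    unfolding pairs sum.distrib by simp
  also have "\<dots> \<le> (\<Sum>c\<in>\<phi> ` S. 3 * card (F c))" using F by (intro sum_mono) fastforce
  finally show "2 * card (\<phi> ` S) + card {(x, y) \<in> S \<times> S. \<phi> x = \<phi> y} \<le> 3 * card S"
    by (simp add: S sum_distrib_left)
  have "(\<Sum>c\<in>\<phi> ` S. card (F c) ^ 2) \<le> (\<Sum>c\<in>\<phi> ` S. 2 * card (F c))"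
    using F by (intro sum_mono) fastforce
  thus "card {(x, y) \<in> S \<times> S. \<phi> x = \<phi> y} \<le> 2 * card S"
    unfolding pairs by (simp add: S sum_distrib_left)
qed

text \<open>
  A set with at most two points on every line has a direction in which it meets at most
  \<open>(p + 1)\<^sup>2/(2p)\<close> lines, about half of them. Summing the first inequality of
  \<open>small_fibres_pairs\<close> over the directions \<open>(1, k)\<close>, and using that two points with different
  second coordinates agree in at least one of them, bounds the total number of lines met by
  \<open>(p + 1)\<^sup>2/2\<close>.
\<close>

lemma narrow_direction:
  fixes S :: "('p::prime_card mod_ring \<times> 'p mod_ring) set"
  assumes "\<And>l. l \<in> lines \<Longrightarrow> card (S \<inter> l) \<le> 2"
  shows "\<exists>a. a \<noteq> 0 \<and> 2 * CARD('p) * card (dot a ` S) \<le> (CARD('p) + 1) ^ 2"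
proof (rule ccontr)
  assume *: "\<not> ?thesis"
  let ?p = "CARD('p)" and ?s = "card S"
  have fib: "card {y \<in> S. dot a y = dot a x} \<le> 2" if "a \<noteq> 0" for a x
  proof -
    have "{y \<in> S. dot a y = dot a x} = S \<inter> affine_line a (dot a x)" by (auto simp: affine_line_def)
    moreover have "affine_line a (dot a x) \<in> lines" using that unfolding lines_def by blast
    ultimately show ?thesis using assms by simp
  qed
  define P where "P k = {(x, y) \<in> S \<times> S. dot (1, k) x = dot (1, k) y}" for k
  define N where "N k = card (dot (1, k) ` S)" for k
  have ne: "(1, k) \<noteq> (0 :: 'p mod_ring \<times> 'p mod_ring)" for k by (simp add: prod_eq_iff)
  have 1: "2 * N k + card (P k) \<le> 3 * ?s" for k
    unfolding N_def P_def by (rule small_fibres_pairs(1)) (rule fib[OF ne])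
  have "card {(x, y) \<in> S \<times> S. dot (0, 1) x = dot (0, 1) y} \<le> 2 * ?s"
    by (rule small_fibres_pairs(2), rule fib) (simp add: prod_eq_iff)
  hence 2: "card {(x, y) \<in> S \<times> S. snd x = snd y} \<le> 2 * ?s" by (simp add: dot_def)
  define T where "T = S \<times> S"
  define Q where "Q k z \<longleftrightarrow> dot (1, k) (fst z) = dot (1, k) (snd z)"
    for k :: "'p mod_ring" and z
  have PQ: "P k = T \<inter> {z. Q k z}" for k by (auto simp: P_def T_def Q_def)
  have 3: "(\<Sum>k\<in>UNIV. card (P k)) = (\<Sum>z\<in>T. card {k. Q k z})"
  proof -
    have "(\<Sum>k\<in>UNIV. card (P k)) = (\<Sum>k\<in>UNIV. \<Sum>z\<in>T. of_bool (Q k z))"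
      unfolding PQ by (simp add: sum_of_bool_eq)
    also have "\<dots> = (\<Sum>z\<in>T. \<Sum>k\<in>UNIV. of_bool (Q k z))" by (rule sum.swap)
    finally show ?thesis by (simp add: sum_of_bool_eq)
  qed
  have 4: "?p * of_bool (fst z = snd z) + of_bool (snd (fst z) \<noteq> snd (snd z)) \<le> card {k. Q k z}"
    for z :: "('p mod_ring \<times> 'p mod_ring) \<times> ('p mod_ring \<times> 'p mod_ring)"
  proof (cases "snd (fst z) = snd (snd z)")
    case False
    hence "(fst (snd z) - fst (fst z)) / (snd (fst z) - snd (snd z)) \<in> {k. Q k z}"
      by (simp add: Q_def dot_def field_simps)
    hence "card {k. Q k z} > 0" by (auto simp: card_gt_0_iff)
    moreover have "fst z \<noteq> snd z" using False by auto
    ultimately show ?thesis by simp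
  qed (auto simp: Q_def)
  have a: "(\<Sum>z\<in>T. of_bool (fst z = snd z)) = ?s"
  proof -
    have "T \<inter> {z. fst z = snd z} = (\<lambda>x. (x, x)) ` S" by (auto simp: T_def)
    moreover have "card \<dots> = ?s" by (rule card_image) (auto intro: inj_onI)
    ultimately show ?thesis by (simp add: sum_of_bool_eq)
  qed
  have b: "(\<Sum>z\<in>T. of_bool (snd (fst z) \<noteq> snd (snd z))) + (\<Sum>z\<in>T. of_bool (snd (fst z) = snd (snd z))) = ?s ^ 2"
  proof -
    have "(\<Sum>z\<in>T. of_bool (snd (fst z) \<noteq> snd (snd z)) + of_bool (snd (fst z) = snd (snd z))) = (\<Sum>z\<in>T. 1 :: nat)"
      by (intro sum.cong) auto
    thus ?thesis by (simp add: sum.distrib T_def card_cartesian_product power2_eq_square)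
  qed
  have c: "(\<Sum>z\<in>T. of_bool (snd (fst z) = snd (snd z))) = card {(x, y) \<in> S \<times> S. snd x = snd y}"
  proof -
    have "{(x, y) \<in> S \<times> S. snd x = snd y} = T \<inter> {z. snd (fst z) = snd (snd z)}" by (auto simp: T_def)
    thus ?thesis by (simp add: sum_of_bool_eq)
  qed
  have "?p * ?s + (\<Sum>z\<in>T. of_bool (snd (fst z) \<noteq> snd (snd z))) \<le> (\<Sum>k\<in>UNIV. card (P k))"
    unfolding 3 a[symmetric] sum_distrib_left sum.distrib[symmetric] by (intro sum_mono 4)
  with b c 2 have 5: "?p * ?s + ?s ^ 2 \<le> (\<Sum>k\<in>UNIV. card (P k)) + 2 * ?s" by linarith
  have "(\<Sum>k\<in>UNIV. 2 * N k) + (\<Sum>k\<in>UNIV. card (P k)) \<le> ?p * (3 * ?s)"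
    using sum_mono[of UNIV "\<lambda>k. 2 * N k + card (P k)" "\<lambda>_. 3 * ?s"] 1 by (simp add: sum.distrib)
  with 5 have "(\<Sum>k\<in>UNIV. 2 * N k) + ?s ^ 2 \<le> 2 * ?s * (?p + 1)"
    using mult.left_commute[of ?p 3 ?s] mult.commute[of ?s ?p] unfolding distrib_left mult.assoc by linarith
  hence "int ((\<Sum>k\<in>UNIV. 2 * N k) + ?s ^ 2) \<le> int (2 * ?s * (?p + 1))" by (simp only: of_nat_le_iff)
  hence "int (\<Sum>k\<in>UNIV. 2 * N k) + int ?s ^ 2 \<le> 2 * int ?s * (int ?p + 1)"
    by (simp only: of_nat_add of_nat_mult of_nat_power of_nat_numeral of_nat_1)
  moreover have "2 * int ?s * (int ?p + 1) \<le> int ?s ^ 2 + (int ?p + 1) ^ 2"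
    using zero_le_power2[of "int ?s - (int ?p + 1)"] unfolding power2_diff by linarith
  ultimately have "int (\<Sum>k\<in>UNIV. 2 * N k) \<le> (int ?p + 1) ^ 2" by linarith
  hence "(\<Sum>k\<in>UNIV. 2 * N k) \<le> (?p + 1) ^ 2"
    by (metis of_nat_le_iff of_nat_Suc of_nat_power add.commute Suc_eq_plus1)
  hence "?p * (\<Sum>k\<in>UNIV. 2 * N k) \<le> ?p * (?p + 1) ^ 2" by simp
  moreover have "?p * (\<Sum>k\<in>UNIV. 2 * N k) > (\<Sum>k\<in>(UNIV::'p mod_ring set). (?p + 1) ^ 2)"
    unfolding sum_distrib_left
  proof (rule sum_strict_mono)
    fix k show "(?p + 1) ^ 2 < ?p * (2 * N k)"
    proof -
      have "\<not> 2 * ?p * N k \<le> (?p + 1) ^ 2" using * ne[of k] unfolding N_def by blast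
      thus ?thesis unfolding not_le by (simp only: mult.left_commute mult.assoc)
    qed
  qed auto
  ultimately show False by simp
qed

section \<open>Supports covered by two lines\<close>

lemma linesI: "a \<noteq> 0 \<Longrightarrow> affine_line a c \<in> lines"
  unfolding lines_def by blast

text \<open>
  A weak form of the classical inequality \<open>|S| |X| \<ge> p\<^sup>2\<close>.
\<close>

lemma dual_support_lower_bound:
  fixes f :: "'p::prime_card mod_ring \<times> 'p mod_ring \<Rightarrow> complex"
  assumes "supp f \<noteq> {}" "card (supp f) < CARD('p)"
  shows "CARD('p) \<le> card (supp (fhat f))"
proof -
  let ?a = "(1, 0) :: 'p mod_ring \<times> 'p mod_ring" and ?p = "CARD('p)"
  obtain x where x: "x \<in> supp f" using assms by auto
  define F where "F = {y \<in> supp f. dot ?a y = dot ?a x}"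
  define m where "m = card F"
  define N where "N = card (dot ?a ` supp f)"
  have "?a \<noteq> 0" by (simp add: prod_eq_iff)
  hence *: "(?p + 1 - m) * (?p + 1 - N) \<le> card (supp (fhat f))"
    unfolding m_def N_def F_def using x by (intro directional_uncertainty) auto
  have F: "F \<subseteq> supp f" "x \<in> F" using x by (auto simp: F_def)
  have "dot ?a ` supp f \<subseteq> insert (dot ?a x) (dot ?a ` (supp f - F))" by (auto simp: F_def)
  hence "N \<le> card (insert (dot ?a x) (dot ?a ` (supp f - F)))" unfolding N_def by (rule card_mono[rotated]) simp
  also have "\<dots> \<le> Suc (card (dot ?a ` (supp f - F)))" by (rule card_insert_le_m1) simp_all
  also have "card (dot ?a ` (supp f - F)) \<le> card (supp f - F)" by (rule card_image_le) simp
  also have "card (supp f - F) = card (supp f) - m" unfolding m_def by (rule card_Diff_subset) (use F in auto)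
  finally have N: "N \<le> Suc (card (supp f) - m)" by simp
  have m: "1 \<le> m" "m \<le> card (supp f)" using F by (auto simp: m_def Suc_le_eq card_gt_0_iff intro: card_mono)
  have N1: "1 \<le> N" using x by (auto simp: N_def Suc_le_eq card_gt_0_iff)
  define u v where "u = ?p - m" and "v = ?p - N"
  have uv: "?p + 1 - m = u + 1" "?p + 1 - N = v + 1" "u + v \<ge> ?p" using m N N1 assms(2) by (auto simp: u_def v_def)
  have "?p \<le> (u + 1) * (v + 1)" using uv(3) by simp
  thus ?thesis using * uv by simp
qed

text \<open>
  The parts of \<open>S\<close> on exactly one line of a family are disjoint, so one of them is at most average.
\<close>

lemma exclusive_part:
  fixes S :: "('a::{field,finite} \<times> 'a) set"
  assumes "\<M> \<subseteq> lines" "\<M> \<noteq> {}"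
  obtains l where "l \<in> \<M>" "card \<M> * card (S \<inter> l - \<Union>(\<M> - {l})) \<le> card S"
proof -
  define E where "E l = S \<inter> l - \<Union>(\<M> - {l})" for l
  have "(\<Sum>l\<in>\<M>. card (E l)) = card (\<Union>l\<in>\<M>. E l)"
    by (rule card_UN_disjoint[symmetric]) (auto simp: E_def)
  also have "\<dots> \<le> card S" by (rule card_mono) (auto simp: E_def)
  finally have sum: "(\<Sum>l\<in>\<M>. card (E l)) \<le> card S" .
  have "\<exists>l\<in>\<M>. card \<M> * card (E l) \<le> card S"
  proof (rule ccontr)
    assume "\<not> ?thesis"
    hence "(\<Sum>l\<in>\<M>. card S) < (\<Sum>l\<in>\<M>. card \<M> * card (E l))"
      by (intro sum_strict_mono) (use assms in auto)
    hence "card \<M> * card S < card \<M> * (\<Sum>l\<in>\<M>. card (E l))" by (simp add: sum_distrib_left)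
    thus False using sum by (simp add: mult_le_mono2 linorder_not_less)
  qed
  thus ?thesis using that unfolding E_def by blast
qed

text \<open>
  The theorem in coordinates, for the case that the support is not larger than the Fourier support.
  The condition on \<open>n\<close> and the bound \<open>p \<le> n\<close> together give \<open>p > 216\<close>, which absorbs all constants.
\<close>

theorem small_support_two_lines:
  fixes f :: "'p::prime_card mod_ring \<times> 'p mod_ring \<Rightarrow> complex" and \<epsilon> :: real
  defines "p \<equiv> real CARD('p)" and "S \<equiv> supp f" and "n \<equiv> real (card (supp (fhat f)))"
  assumes ne: "S \<noteq> {}" and eps: "0 < \<epsilon>" "\<epsilon> < 1"
    and S: "real (card S) < 3 * (1 - \<epsilon>) * p"
    and n: "n < 1 / 6 * \<epsilon> * p powr (4 / 3)"
    and Sn: "real (card S) \<le> n"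
  shows "\<exists>l\<in>lines. \<exists>l'\<in>lines. S \<subseteq> l \<union> l'"
proof -
  define q where "q = p powr (1 / 3)"
  have p1: "p > 1" using prime_gt_1_nat[OF prime_card[where 'a = 'p]] by (simp add: p_def)
  have q0: "q > 0" using p1 by (simp add: q_def)
  have pq: "p = q ^ 3" using p1 by (simp add: q_def powr_power)
  have "p powr (4 / 3) = q ^ 4" using p1 by (simp add: q_def powr_power)
  hence nq: "n < \<epsilon> * q ^ 4 / 6" using n by simp
  have n0: "n \<ge> 0" by (simp add: n_def)
  have "p \<le> n"
  proof (cases "card S < CARD('p)")
    case True
    thus ?thesis using dual_support_lower_bound[of f] ne by (simp add: p_def n_def S_def)
  next
    case False
    thus ?thesis using Sn by (simp add: p_def)
  qed
  hence "q ^ 3 < \<epsilon> * q ^ 4 / 6" using nq pq by simp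
  hence "q ^ 3 * 6 < q ^ 3 * (\<epsilon> * q)" by (simp add: power_numeral_reduce algebra_simps)
  hence "6 < \<epsilon> * q" using q0 by simp
  also have "\<dots> \<le> q" using eps q0 by simp
  finally have q6: "q > 6" .
  have "6 ^ 3 < q ^ 3" using q6 by (intro power_strict_mono) auto
  hence p216: "p > 216" using pq by simp
  have q2: "q ^ 2 > 36" using power_strict_mono[of 6 q 2] q6 by simp

  have rich: "2 / 3 * p < real (card (S \<inter> l))" if l: "l \<in> lines" "card (S \<inter> l) \<ge> 3" for l
  proof -
    obtain a c where ac: "l = affine_line a c" "a \<noteq> 0" using l unfolding lines_def by auto
    have fib: "{x \<in> supp f. dot a x = c} = S \<inter> affine_line a c" for c
      by (auto simp: S_def affine_line_def)
    define m where "m = card (S \<inter> l)"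
    define Z where "Z = {c. card (S \<inter> affine_line a c) \<le> 2}"
    have bound: "(CARD('p) + 1 - m) ^ 3 * card Z \<le> 6 * card (supp (fhat f)) ^ 3"
      using line_bound[of a f c m] l ac unfolding fib by (simp add: m_def Z_def)
    \<comment> \<open>the lines outside \<open>Z\<close> have at least three points each\<close>
    have "3 * (CARD('p) - card Z) = (\<Sum>c\<in>- Z. 3)"
      by (simp add: Compl_eq_Diff_UNIV card_Diff_subset)
    also have "\<dots> \<le> (\<Sum>c\<in>- Z. card (S \<inter> affine_line a c))"
      by (rule sum_mono) (auto simp: Z_def)
    also have "\<dots> = card (\<Union>c\<in>- Z. S \<inter> affine_line a c)"
      by (rule card_UN_disjoint[symmetric]) (auto simp: affine_line_def)
    also have "\<dots> \<le> card S" by (rule card_mono) auto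
    finally have "3 * (CARD('p) - card Z) \<le> card S" .
    hence "real (3 * (CARD('p) - card Z)) \<le> real (card S)" by (rule of_nat_mono)
    moreover have "card Z \<le> CARD('p)" using card_mono[of UNIV Z] by simp
    ultimately have "3 * (p - real (card Z)) \<le> real (card S)" by (simp add: p_def of_nat_diff)
    hence Z: "\<epsilon> * p < real (card Z)" using S by (simp add: algebra_simps)
    define k where "k = real (CARD('p) + 1 - m)"
    have "k ^ 3 * real (card Z) \<le> 6 * n ^ 3"
      using of_nat_mono[OF bound, where 'a = real] by (simp add: k_def n_def)
    moreover have "k ^ 3 * (\<epsilon> * p) \<le> k ^ 3 * real (card Z)"
      using Z by (intro mult_left_mono) (auto simp: k_def)
    moreover have "n ^ 3 < (\<epsilon> * q ^ 4 / 6) ^ 3" using nq n0 by (intro power_strict_mono) auto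
    ultimately have "k ^ 3 * (\<epsilon> * p) < 6 * (\<epsilon> * q ^ 4 / 6) ^ 3" by linarith
    also have "\<dots> = (\<epsilon> * p) * (\<epsilon> ^ 2 * p ^ 3 / 36)"
      unfolding pq by (simp add: field_simps power_numeral_reduce)
    finally have "k ^ 3 < \<epsilon> ^ 2 * p ^ 3 / 36"
      using eps p1 by (subst (asm) mult.commute) (simp add: mult_less_cancel_left_pos)
    also have "\<dots> \<le> 1 * p ^ 3 / 36"
      using eps p1 by (intro divide_right_mono mult_right_mono power_le_one) auto
    also have "\<dots> < (p / 3) ^ 3" using p1 by (simp add: power_divide)
    finally have "k < p / 3" using p1 by (intro power_less_imp_less_base[of k 3 "p / 3"]) auto
    thus ?thesis unfolding k_def m_def p_def by linarith
  qed

  define \<M> where "\<M> = {l \<in> lines. card (S \<inter> l) \<ge> 3}"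
  have M: "\<M> \<subseteq> lines" by (auto simp: \<M>_def)
  have M4: "card \<M> \<le> 4"
  proof (rule ccontr)
    assume "\<not> ?thesis"
    \<comment> \<open>five rich lines would have more than \<open>10p/3 - 25\<close> points of \<open>S\<close>\<close>
    then obtain \<N> where N: "\<N> \<subseteq> \<M>" "card \<N> = 5"
      by (metis obtain_subset_with_card_n not_less_eq_eq Suc_numeral semiring_norm(2,5,8) add_One)
    define m where "m = Min ((\<lambda>l. card (S \<inter> l)) ` \<N>)"
    have "\<N> \<noteq> {}" using N by auto
    hence m: "m \<in> (\<lambda>l. card (S \<inter> l)) ` \<N>" "\<And>l. l \<in> \<N> \<Longrightarrow> m \<le> card (S \<inter> l)"
      unfolding m_def by (auto intro: Min_in)
    have "card \<N> * m \<le> card (S \<inter> \<Union>\<N>) + card \<N> ^ 2"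
      by (rule card_Union_lines) (use N M m in auto)
    also have "card (S \<inter> \<Union>\<N>) \<le> card S" by (rule card_mono) auto
    finally have "5 * m \<le> card S + 25" using N by simp
    hence "5 * real m \<le> real (card S) + 25" by linarith
    moreover have "2 / 3 * p < real m" using m(1) rich N by (auto simp: \<M>_def)
    moreover have "real (card S) \<le> 3 * p"
    proof -
      have "3 * (1 - \<epsilon>) * p \<le> 3 * p" using eps p1 by (simp add: algebra_simps)
      thus ?thesis using S by linarith
    qed
    ultimately show False using p216 by linarith
  qed

  \<comment> \<open>the part of \<open>S\<close> on no rich line has at most two points on every line\<close>
  have cover: "S \<subseteq> \<Union>\<M>"
  proof (rule ccontr)
    assume "\<not> ?thesis"
    then obtain x where x: "x \<in> S" "x \<notin> \<Union>\<M>" by auto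
    obtain f' where f': "supp f' = S - \<Union>\<M>"
      "card (supp (fhat f')) \<le> 2 ^ card \<M> * card (supp (fhat f))"
      using remove_lines[OF M, of f] unfolding S_def by auto
    have few: "card (supp f' \<inter> l) \<le> 2" if l: "l \<in> lines" for l
    proof (cases "l \<in> \<M>")
      case True
      hence "supp f' \<inter> l = {}" using f'(1) by auto
      thus ?thesis by simp
    next
      case False
      hence "card (S \<inter> l) \<le> 2" using l by (auto simp: \<M>_def)
      moreover have "card (supp f' \<inter> l) \<le> card (S \<inter> l)" using f'(1) by (intro card_mono) auto
      ultimately show ?thesis by simp
    qed
    obtain a where a: "a \<noteq> 0" "2 * CARD('p) * card (dot a ` supp f') \<le> (CARD('p) + 1) ^ 2"
      using narrow_direction[OF few] by auto
    define N where "N = card (dot a ` supp f')"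
    define m where "m = card {y \<in> supp f'. dot a y = dot a x}"
    have m: "m \<le> 2"
      using few[OF linesI[OF a(1)], of "dot a x"] by (simp add: m_def affine_line_def Int_def)
    have "(CARD('p) + 1 - m) * (CARD('p) + 1 - N) \<le> card (supp (fhat f'))"
      unfolding m_def N_def using a(1) x f'(1) by (intro directional_uncertainty) auto
    also have "\<dots> \<le> 2 ^ card \<M> * card (supp (fhat f))" by (rule f'(2))
    also have "\<dots> \<le> 2 ^ 4 * card (supp (fhat f))" using M4 by (intro mult_right_mono power_increasing) auto
    finally have "(CARD('p) + 1 - m) * (CARD('p) + 1 - N) \<le> 16 * card (supp (fhat f))" by simp
    hence "real (CARD('p) + 1 - m) * real (CARD('p) + 1 - N) \<le> 16 * n"
      unfolding n_def of_nat_mult[symmetric] by linarith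
    moreover have "N \<le> CARD('p)"
      using card_mono[of UNIV "dot a ` supp f'"] by (simp add: N_def)
    hence "(p - 1) * (p + 1 - real N) \<le> real (CARD('p) + 1 - m) * real (CARD('p) + 1 - N)"
      using m p1 by (intro mult_mono') (auto simp: p_def)
    ultimately have 1: "(p - 1) * (p + 1 - real N) \<le> 16 * n" by linarith
    have "2 * p * real N \<le> (p + 1) ^ 2"
      using of_nat_mono[OF a(2), where 'a = real] by (simp add: p_def N_def algebra_simps)
    hence "2 * p * (p + 1 - real N) \<ge> (p + 1) * (p - 1)"
      by (simp add: algebra_simps power2_eq_square)
    hence "(p - 1) * ((p + 1) * (p - 1)) \<le> (p - 1) * (2 * p * (p + 1 - real N))"
      using p1 by (intro mult_left_mono) auto
    also have "\<dots> = 2 * p * ((p - 1) * (p + 1 - real N))" by simp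
    also have "\<dots> \<le> 2 * p * (16 * n)" using 1 p1 by (intro mult_left_mono) auto
    finally have 2: "(p - 1) * ((p + 1) * (p - 1)) \<le> 32 * (p * n)" by simp
    have "p * p * (p / 2) \<le> (p - 1) * ((p + 1) * (p - 1))"
    proof -
      have "1 * 2 \<le> p * (p / 2 - 1)" using p216 by (intro mult_mono) auto
      hence "0 \<le> p * (p * (p / 2 - 1) - 1) + 1" using p1 by (intro add_nonneg_nonneg mult_nonneg_nonneg) auto
      moreover have "(p - 1) * ((p + 1) * (p - 1)) - p * p * (p / 2) = p * (p * (p / 2 - 1) - 1) + 1"
        by (simp add: algebra_simps)
      ultimately show ?thesis by linarith
    qed
    hence "p * (p * p / 2) \<le> p * (32 * n)" using 2 by simp
    hence "p * p / 2 \<le> 32 * n" using p1 by (simp only: mult_le_cancel_left_pos)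
    hence "p * p \<le> 64 * n" by simp
    also have "\<dots> \<le> 64 * (\<epsilon> * q ^ 4 / 6)" using nq by simp
    also have "\<dots> \<le> 64 * (1 * q ^ 4 / 6)" using eps q0 by (intro mult_left_mono divide_right_mono mult_right_mono) auto
    finally have "q ^ 4 * q ^ 2 \<le> q ^ 4 * (32 / 3)" unfolding pq by (simp add: power_numeral_reduce algebra_simps)
    hence "q ^ 2 \<le> 32 / 3" using q0 by (simp only: mult_le_cancel_left_pos zero_less_power)
    thus False using q2 by simp
  qed
  have Mne: "\<M> \<noteq> {}" using cover ne by auto

  have "card \<M> \<le> 2"
  proof (rule ccontr)
    assume "\<not> ?thesis"
    hence M3: "card \<M> \<ge> 3" by simp
    obtain l where l: "l \<in> \<M>" "card \<M> * card (S \<inter> l - \<Union>(\<M> - {l})) \<le> card S"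
      using exclusive_part[OF M Mne] .
    define E where "E = S \<inter> l - \<Union>(\<M> - {l})"
    have cM: "card (\<M> - {l}) \<le> 3" using M4 l(1) by simp
    have "3 * card E \<le> card \<M> * card E" using M3 by simp
    hence "3 * card E \<le> card S" using l(2) unfolding E_def by linarith
    hence "3 * real (card E) \<le> real (card S)" by linarith
    hence E: "real (card E) < (1 - \<epsilon>) * p" using S unfolding mult.assoc by linarith
    have "card (S \<inter> l) \<le> card (E \<union> (l \<inter> \<Union>(\<M> - {l})))" by (rule card_mono) (auto simp: E_def)
    also have "\<dots> \<le> card E + card (l \<inter> \<Union>(\<M> - {l}))" by (rule card_Un_le)
    also have "card (l \<inter> \<Union>(\<M> - {l})) \<le> card (\<M> - {l})" using l M by (intro card_line_Int_Union) auto
    finally have "card (S \<inter> l) \<le> card E + 3" using cM by simp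
    moreover have "2 / 3 * p < real (card (S \<inter> l))" using l rich by (auto simp: \<M>_def)
    ultimately have "card E > 0" using p216 by linarith
    then obtain x where x: "x \<in> E" by (auto simp: card_gt_0_iff)
    obtain f' where f': "supp f' = S - \<Union>(\<M> - {l})"
      "card (supp (fhat f')) \<le> 2 ^ card (\<M> - {l}) * card (supp (fhat f))"
      using remove_lines[of "\<M> - {l}" f] M unfolding S_def by auto
    have fE: "supp f' = E" using f'(1) cover l(1) by (auto simp: E_def)
    obtain a c where ac: "l = affine_line a c" "a \<noteq> 0" using l M unfolding lines_def by auto
    have Eac: "dot a y = c" if "y \<in> E" for y using that by (auto simp: E_def ac affine_line_def)
    have "(CARD('p) + 1 - card {y \<in> supp f'. dot a y = c}) * (CARD('p) + 1 - card (dot a ` supp f')) \<le> card (supp (fhat f'))"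
      by (rule directional_uncertainty[OF ac(2), of x]) (use x Eac fE in auto)
    also have "{y \<in> supp f'. dot a y = c} = E" using fE Eac by auto
    also have "dot a ` supp f' = {c}" using fE Eac x by auto
    also have "card (supp (fhat f')) \<le> 2 ^ 3 * card (supp (fhat f))"
      by (rule order_trans[OF f'(2)]) (use cM in \<open>intro mult_right_mono power_increasing, auto\<close>)
    finally have "(CARD('p) + 1 - card E) * CARD('p) \<le> 8 * card (supp (fhat f))" by simp
    hence "real (CARD('p) + 1 - card E) * p \<le> 8 * n"
      unfolding n_def p_def of_nat_mult[symmetric] by linarith
    moreover have "\<epsilon> * p \<le> real (CARD('p) + 1 - card E)"
      using E by (simp add: p_def algebra_simps)
    hence "\<epsilon> * p * p \<le> real (CARD('p) + 1 - card E) * p"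
      using p1 by (intro mult_right_mono) auto
    ultimately have "\<epsilon> * p * p \<le> 8 * (\<epsilon> * q ^ 4 / 6)" using nq by linarith
    hence "(\<epsilon> * q ^ 4) * q ^ 2 \<le> (\<epsilon> * q ^ 4) * (4 / 3)"
      unfolding pq by (simp add: power_numeral_reduce algebra_simps)
    moreover have "\<epsilon> * q ^ 4 > 0" using eps q0 by simp
    ultimately have "q ^ 2 \<le> 4 / 3" by (simp only: mult_le_cancel_left_pos)
    thus False using q2 by simp
  qed
  moreover have "card \<M> \<noteq> 0" using Mne by simp
  ultimately consider "card \<M> = 1" | "card \<M> = 2" by linarith
  thus ?thesis
  proof cases
    case 1
    then obtain l where "\<M> = {l}" by (auto simp: card_1_singleton_iff)
    hence "l \<in> lines" "S \<subseteq> l \<union> l" using cover M by simp_all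
    thus ?thesis by blast
  next
    case 2
    then obtain l l' where "\<M> = {l, l'}" by (auto simp: card_2_iff)
    hence "l \<in> lines" "l' \<in> lines" "S \<subseteq> l \<union> l'" using cover M by simp_all
    thus ?thesis by blast
  qed
qed

section \<open>Characters and cosets\<close>

text \<open>
  The character of the plane with index \<open>a\<close>. The sign makes the complex conjugate in the definition
  of the Fourier transform match \<open>fhat\<close>.
\<close>

definition character :: "'p::prime_card mod_ring \<times> 'p mod_ring \<Rightarrow> 'p mod_ring \<times> 'p mod_ring \<Rightarrow> complex" where
  "character a = (\<lambda>x. add_char (- dot a x))"

lemma additive_group_simps [simp]:
  "carrier (additive_group :: 'a::ab_group_add monoid) = UNIV"
  "x \<otimes>\<^bsub>additive_group\<^esub> y = x + (y :: 'a)"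
  "\<one>\<^bsub>additive_group\<^esub> = (0 :: 'a)"
  by (simp_all add: additive_group_def)

lemma carrier_dual_additive_group:
  "\<phi> \<in> carrier (dual_group (additive_group :: 'a::ab_group_add monoid)) \<longleftrightarrow>
    (\<forall>x. \<phi> x \<noteq> 0) \<and> (\<forall>x y. \<phi> (x + y) = \<phi> x * \<phi> y)"
  by (auto simp: dual_group_def complex_mult_group_def hom_def)

lemma range_add_char: "range (add_char :: 'p::prime_card mod_ring \<Rightarrow> complex) = {z. z ^ CARD('p) = 1}"
proof (rule card_subset_eq)
  have "add_char x ^ CARD('p) = 1" for x :: "'p mod_ring"
    using add_char_of_nat_mult[of "CARD('p)" x] by simp
  thus "range (add_char :: 'p mod_ring \<Rightarrow> complex) \<subseteq> {z. z ^ CARD('p) = 1}" by auto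
  show "finite {z::complex. z ^ CARD('p) = 1}" by (rule finite_roots_unity) simp
  show "card (range (add_char :: 'p mod_ring \<Rightarrow> complex)) = card {z::complex. z ^ CARD('p) = 1}"
    by (simp add: card_image[OF inj_add_char] card_roots_unity_eq)
qed

lemma hom_eq_add_char:
  fixes \<psi> :: "'p::prime_card mod_ring \<Rightarrow> complex"
  assumes "\<psi> 0 = 1" "\<And>x y. \<psi> (x + y) = \<psi> x * \<psi> y"
  shows "\<exists>u. \<forall>x. \<psi> x = add_char (u * x)"
proof -
  have pow: "\<psi> (of_nat n) = \<psi> 1 ^ n" for n
    by (induction n) (simp_all add: assms)
  have "\<psi> 1 \<in> range (add_char :: 'p mod_ring \<Rightarrow> complex)"
    unfolding range_add_char using pow[of "CARD('p)"] assms by simp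
  then obtain u :: "'p mod_ring" where u: "\<psi> 1 = add_char u" by auto
  have "\<psi> x = add_char (u * x)" for x
  proof -
    have "\<psi> x = add_char u ^ residue x" using pow[of "residue x"] u by simp
    also have "\<dots> = add_char (x * u)" by (rule add_char_mult[symmetric])
    finally show ?thesis by (simp add: mult.commute)
  qed
  thus ?thesis by blast
qed

lemma bij_character:
  "bij_betw character UNIV (carrier (dual_group (additive_group :: ('p::prime_card mod_ring \<times> 'p mod_ring) monoid)))"
proof (rule bij_betwI')
  fix a b :: "'p mod_ring \<times> 'p mod_ring"
  show "character a = character b \<longleftrightarrow> a = b"
  proof
    assume "character a = character b"
    hence "character a (1, 0) = character b (1, 0)" "character a (0, 1) = character b (0, 1)" by auto
    thus "a = b" by (simp add: character_def dot_def inj_eq[OF inj_add_char] prod_eq_iff)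
  qed simp
next
  fix a :: "'p mod_ring \<times> 'p mod_ring"
  show "character a \<in> carrier (dual_group additive_group)"
    unfolding carrier_dual_additive_group character_def
    by (simp add: dot_add_right flip: add_char_add)
next
  fix \<phi> assume "\<phi> \<in> carrier (dual_group (additive_group :: ('p mod_ring \<times> 'p mod_ring) monoid))"
  hence nz: "\<phi> x \<noteq> 0" and hom: "\<phi> (x + y) = \<phi> x * \<phi> y" for x y
    unfolding carrier_dual_additive_group by blast+
  have one: "\<phi> 0 = 1" using hom[of 0 0] nz[of 0] by simp
  obtain u where u: "\<And>x. \<phi> (x, 0) = add_char (u * x)"
    using hom_eq_add_char[of "\<lambda>x. \<phi> (x, 0)"] one hom by (auto simp: zero_prod_def simp flip: hom)
  obtain v where v: "\<And>y. \<phi> (0, y) = add_char (v * y)"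
    using hom_eq_add_char[of "\<lambda>y. \<phi> (0, y)"] one hom by (auto simp: zero_prod_def simp flip: hom)
  have "\<phi> = character (- u, - v)"
  proof
    fix x
    have "\<phi> x = \<phi> (fst x, 0) * \<phi> (0, snd x)" using hom[of "(fst x, 0)" "(0, snd x)"] by simp
    thus "\<phi> x = character (- u, - v) x" by (simp add: u v character_def dot_def add_char_add)
  qed
  thus "\<exists>a\<in>UNIV. \<phi> = character a" by blast
qed

lemma fourier_character:
  fixes f :: "'p::prime_card mod_ring \<times> 'p mod_ring \<Rightarrow> complex"
  shows "fourier additive_group f (character a) = fhat f a / of_nat CARD('p) ^ 2"
  by (simp add: fourier_def fhat_def character_def cnj_add_char order_def power2_eq_square)

lemma line_proper_coset:
  assumes "l \<in> lines"
  shows "l \<in> proper_cosets (additive_group :: ('p::prime_card mod_ring \<times> 'p mod_ring) monoid)"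
proof -
  obtain a c where l: "l = affine_line a c" "a \<noteq> 0" using assms unfolding lines_def by auto
  have a: "fst a \<noteq> 0 \<or> snd a \<noteq> 0" using l by (auto simp: prod_eq_iff)
  have ex: "\<exists>y. dot a y = d" for d
  proof (cases "fst a = 0")
    case True
    thus ?thesis using a by (intro exI[of _ "(0, d / snd a)"]) (simp add: dot_def)
  next
    case False
    thus ?thesis by (intro exI[of _ "(d / fst a, 0)"]) (simp add: dot_def)
  qed
  let ?G = "additive_group :: ('p mod_ring \<times> 'p mod_ring) monoid"
  interpret comm_group ?G by (rule comm_group_additive_group)
  define H where "H = affine_line a 0"
  have sub: "subgroup H ?G"
  proof (rule subgroupI)
    fix x assume x: "x \<in> H"
    have "inv\<^bsub>?G\<^esub> x = - x" by (rule inv_equality) auto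
    thus "inv\<^bsub>?G\<^esub> x \<in> H" using x by (simp add: H_def affine_line_def dot_minus_right)
  next
    have "0 \<in> H" by (simp add: H_def affine_line_def dot_def)
    thus "H \<noteq> {}" by blast
  qed (auto simp: H_def affine_line_def dot_add_right)
  have "(snd a, - fst a) \<in> H" by (simp add: H_def affine_line_def dot_def)
  moreover have "(snd a, - fst a) \<noteq> 0" using a by (auto simp: prod_eq_iff)
  ultimately have ne1: "H \<noteq> {\<one>\<^bsub>?G\<^esub>}" by auto
  obtain y1 where "dot a y1 = 1" using ex by blast
  hence "y1 \<notin> H" by (simp add: H_def affine_line_def)
  hence ne2: "H \<noteq> carrier ?G" by auto
  obtain y where y: "dot a y = c" using ex by blast
  have "l = H #>\<^bsub>?G\<^esub> y"
  proof (intro equalityI subsetI)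
    fix x assume "x \<in> l"
    hence "x - y \<in> H" using y by (simp add: l H_def affine_line_def dot_def algebra_simps)
    thus "x \<in> H #>\<^bsub>?G\<^esub> y" unfolding r_coset_def by (intro UN_I[of "x - y"]) auto
  next
    fix x assume "x \<in> H #>\<^bsub>?G\<^esub> y"
    then obtain h where "h \<in> H" "x = h + y" by (auto simp: r_coset_def)
    thus "x \<in> l" using y by (simp add: l H_def affine_line_def dot_def algebra_simps)
  qed
  hence "l \<in> rcosets\<^bsub>?G\<^esub> H" unfolding RCOSETS_def by (intro UN_I[of y]) simp_all
  thus ?thesis unfolding proper_cosets_def using sub ne1 ne2 by blast
qed

lemma iso_proper_coset:
  assumes "group G" "group K" "h \<in> hom G K" "bij_betw h (carrier G) (carrier K)" "C \<in> proper_cosets G"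
  shows "h ` C \<in> proper_cosets K"
proof -
  interpret group_hom G K h using assms by (simp add: group_hom_def group_hom_axioms_def)
  obtain H x where H: "subgroup H G" "H \<noteq> {\<one>\<^bsub>G\<^esub>}" "H \<noteq> carrier G" and x: "x \<in> carrier G" "C = H #>\<^bsub>G\<^esub> x"
    using assms(5) unfolding proper_cosets_def RCOSETS_def by auto
  have HG: "H \<subseteq> carrier G" "\<one>\<^bsub>G\<^esub> \<in> H" using H(1) by (auto simp: subgroup_def)
  have inj: "inj_on h (carrier G)" and img: "h ` carrier G = carrier K"
    using assms(4) by (auto simp: bij_betw_def)
  have "h ` H \<noteq> h ` {\<one>\<^bsub>G\<^esub>}"
    using inj_on_image_eq_iff[OF inj, of H "{\<one>\<^bsub>G\<^esub>}"] HG H(2) by auto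
  hence ne1: "h ` H \<noteq> {\<one>\<^bsub>K\<^esub>}" by simp
  have "h ` H \<noteq> h ` carrier G"
    using inj_on_image_eq_iff[OF inj, of H "carrier G"] HG H(3) by auto
  hence ne2: "h ` H \<noteq> carrier K" unfolding img .
  have sub: "subgroup (h ` H) K" using H(1) by (rule subgroup_img_is_subgroup)
  have "h (y \<otimes>\<^bsub>G\<^esub> x) = h y \<otimes>\<^bsub>K\<^esub> h x" if "y \<in> H" for y
    using that HG x(1) by (intro hom_mult) auto
  hence "h ` C = h ` H #>\<^bsub>K\<^esub> h x" unfolding x(2) r_coset_def by (auto simp: image_UN)
  hence "h ` C \<in> rcosets\<^bsub>K\<^esub> (h ` H)"
    unfolding RCOSETS_def using x(1) by (intro UN_I[of "h x"]) simp_all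
  thus ?thesis unfolding proper_cosets_def using sub ne1 ne2 by blast
qed

lemma character_line_proper_coset:
  fixes l :: "('p::prime_card mod_ring \<times> 'p mod_ring) set"
  assumes "l \<in> lines"
  shows "character ` l \<in> proper_cosets (dual_group additive_group)"
proof (rule iso_proper_coset)
  show 1: "group (additive_group :: ('p mod_ring \<times> 'p mod_ring) monoid)"
    using comm_group_additive_group by (rule comm_group.axioms)
  show "group (dual_group (additive_group :: ('p mod_ring \<times> 'p mod_ring) monoid))"
    using comm_group_dual_group[OF 1] by (rule comm_group.axioms)
  show "bij_betw character (carrier additive_group) (carrier (dual_group (additive_group :: ('p mod_ring \<times> 'p mod_ring) monoid)))"
    using bij_character by simp
  show "l \<in> proper_cosets additive_group" using assms by (rule line_proper_coset)
  show "character \<in> hom additive_group (dual_group (additive_group :: ('p mod_ring \<times> 'p mod_ring) monoid))"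
  proof (rule homI)
    fix a b :: "'p mod_ring \<times> 'p mod_ring"
    show "character a \<in> carrier (dual_group additive_group)" using bij_character by (auto simp: bij_betw_def)
    show "character (a \<otimes>\<^bsub>additive_group\<^esub> b) = character a \<otimes>\<^bsub>dual_group additive_group\<^esub> character b"
      by (auto simp: dual_group_def character_def dot_add_left fun_eq_iff simp flip: add_char_add)
  qed
qed

theorem theorem5:
  fixes f :: "'p::prime_card mod_ring \<times> 'p mod_ring \<Rightarrow> complex"
    and G :: "('p mod_ring \<times> 'p mod_ring) monoid"
    and S :: "('p mod_ring \<times> 'p mod_ring) set"
    and X :: "('p mod_ring \<times> 'p mod_ring \<Rightarrow> complex) set"
    and p :: nat and \<epsilon> :: real
  assumes "p = CARD('p)"
    and "G = additive_group"
    and "f \<noteq> (\<lambda>_. 0)"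
    and "S = support_on (carrier G) f"
    and "X = support_on (carrier (dual_group G)) (fourier G f)"
    and "0 < \<epsilon>" and "\<epsilon> < 1"
  shows "real (min (card S) (card X)) \<ge> 3 * (1 - \<epsilon>) * real p
       \<or> real (max (card S) (card X)) \<ge> 1 / 6 * \<epsilon> * real p powr (4 / 3)
       \<or> ((card S \<le> card X \<longrightarrow> in_one_or_two_proper_cosets G S) \<and>
          (card X \<le> card S \<longrightarrow> in_one_or_two_proper_cosets (dual_group G) X))"
proof -
  have S: "S = supp f" by (simp add: assms(2,4) support_on_def supp_def)
  have X: "X = character ` supp (fhat f)"
  proof -
    have car: "carrier (dual_group G) = range character"
      using bij_character[where 'p = 'p] by (simp add: bij_betw_def assms(2))
    have "X = character ` {a. fourier G f (character a) \<noteq> 0}"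
      unfolding assms(5) support_on_def car by auto
    also have "{a. fourier G f (character a) \<noteq> 0} = supp (fhat f)"
      unfolding assms(2) fourier_character by (simp add: supp_def)
    finally show ?thesis .
  qed
  have cX: "card X = card (supp (fhat f))"
    unfolding X using bij_character[where 'p = 'p]
    by (intro card_image) (auto simp: bij_betw_def intro: inj_on_subset)
  have neS: "supp f \<noteq> {}" using assms(3) by (auto simp: supp_def)
  \<comment> \<open>exchanging the roles of \<open>S\<close> and \<open>X\<close> reflects \<open>S\<close>, which preserves its size\<close>
  have "supp (fhat (fhat f)) = uminus ` supp f"
  proof (intro equalityI subsetI)
    fix x assume "x \<in> supp (fhat (fhat f))"
    hence "- x \<in> supp f" by (simp add: supp_def fhat_fhat)
    thus "x \<in> uminus ` supp f" by (rule image_eqI[rotated]) simp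
  qed (auto simp: supp_def fhat_fhat)
  hence cS: "card (supp (fhat (fhat f))) = card S" by (simp add: S card_image)
  have neX: "supp (fhat f) \<noteq> {}"
  proof
    assume "supp (fhat f) = {}"
    hence "fhat f = (\<lambda>_. 0)" by (auto simp: supp_def)
    hence "fhat (fhat f) = (\<lambda>_. 0)" by (auto simp: fhat_def)
    hence "f x = 0" for x using fhat_fhat[of f "- x"] by simp
    thus False using neS by (auto simp: supp_def)
  qed
  have direct: "in_one_or_two_proper_cosets G S"
    if le: "card S \<le> card X" and less: "real (card S) < 3 * (1 - \<epsilon>) * real p"
      "real (card X) < 1 / 6 * \<epsilon> * real p powr (4 / 3)"
  proof -
    have "\<exists>l\<in>lines. \<exists>l'\<in>lines. S \<subseteq> l \<union> l'"
      unfolding S by (rule small_support_two_lines)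
        (use neS assms(6,7) le less in \<open>simp_all only: S cX assms(1) of_nat_le_iff not_False_eq_True\<close>)
    thus ?thesis unfolding in_one_or_two_proper_cosets_def assms(2) using line_proper_coset by blast
  qed
  have dual: "in_one_or_two_proper_cosets (dual_group G) X"
    if le: "card X \<le> card S" and less: "real (card X) < 3 * (1 - \<epsilon>) * real p"
      "real (card S) < 1 / 6 * \<epsilon> * real p powr (4 / 3)"
  proof -
    have "\<exists>l\<in>lines. \<exists>l'\<in>lines. supp (fhat f) \<subseteq> l \<union> l'"
      by (rule small_support_two_lines)
        (use neX assms(6,7) le less in \<open>simp_all only: cS cX assms(1) of_nat_le_iff not_False_eq_True\<close>)
    then obtain l l' where l: "l \<in> lines" "l' \<in> lines" "supp (fhat f) \<subseteq> l \<union> l'" by blast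
    hence "X \<subseteq> character ` l \<union> character ` l'" unfolding X by auto
    thus ?thesis unfolding in_one_or_two_proper_cosets_def assms(2)
      using character_line_proper_coset l(1,2) by blast
  qed
  show ?thesis
  proof (cases "3 * (1 - \<epsilon>) * real p \<le> real (min (card S) (card X))
      \<or> 1 / 6 * \<epsilon> * real p powr (4 / 3) \<le> real (max (card S) (card X))")
    case False
    hence lt: "real (min (card S) (card X)) < 3 * (1 - \<epsilon>) * real p"
        "real (max (card S) (card X)) < 1 / 6 * \<epsilon> * real p powr (4 / 3)"
      by (simp_all only: de_Morgan_disj not_le)
    have "in_one_or_two_proper_cosets G S" if le: "card S \<le> card X"
      using direct[OF le] lt by (simp only: min_absorb1[OF le] max_absorb2[OF le])
    moreover have "in_one_or_two_proper_cosets (dual_group G) X" if le: "card X \<le> card S"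
      using dual[OF le] lt by (simp only: min_absorb2[OF le] max_absorb1[OF le])
    ultimately show ?thesis by blast
  qed blast
qed

end
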